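(* Let $H$ be a separable complex Hilbert space, let $T \in B(H)$ be a quasidiagonal operator and let $P_1 \leq P_2 \leq \cdots$ be any filtration of $H$ which asymptotically commutes with $T$, i.e. $\|[P_n,T]\| \to 0$. Then the following statements hold: (1) For every $\varepsilon > 0$, $\sigma^{(\varepsilon)}(P_nTP_n) \to \sigma^{(\varepsilon)}(T)$. (2) $\sigma(T) = \bigcap_{\varepsilon > 0}\big(\lim_{n\to\infty} \sigma^{(\varepsilon)}(P_nTP_n)\big)$, where $\lim_{n\to\infty} \sigma^{(\varepsilon)}(P_nTP_n) = \sigma^{(\varepsilon)}(T)$ by (1). (3) $\sigma_2(P_nTP_n) \to \sigma_2(T)$. Here convergence of compact subsets of $\mathbb{C}$ is with respect to the Hausdorff distance.
   Context: A filtration of $H$ is a sequence of finite rank orthogonal projections $P_n = P_n^* = P_n^2$ with $P_nH \subset P_{n+1}H$ for all $n$ and $\|P_n v - v\| \to 0$ for all $v \in H$. $[P,T] = PT - TP$. An operator $T \in B(H)$ is quasidiagonal if there exist finite rank orthogonal projections $Q_n$ with $\|Q_n v - v\| \to 0$ for all $v \in H$ and $\|[T,Q_n]\| \to 0$. $P_nTP_n$ is regarded as an operator on the finite dimensional space $P_nH$ (i.e. as a matrix), and its spectral quantities are computed there. For $\varepsilon > 0$ the $\varepsilon$-pseudospectrum of an operator $X$ is $\sigma^{(\varepsilon)}(X) = \{\lambda \in \mathbb{C} : \|(\lambda - X)^{-1}\| \geq 1/\varepsilon\}$, with the convention that $\|Y^{-1}\| = \infty$ if $Y$ is not invertible. The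 set of singular values of $X$ is $\sigma_2(X) = \{\lambda \geq 0 : \lambda^2 \in \sigma(X^*X)\}$. For compact sets $\Sigma_n, \Sigma \subset \mathbb{C}$, $\Sigma_n \to \Sigma$ means $d_H(\Sigma_n,\Sigma) \to 0$, where $d_H(\Sigma,\Lambda) = \max\{\sup_{\sigma\in\Sigma} d(\sigma,\Lambda), \sup_{\lambda\in\Lambda} d(\lambda,\Sigma)\}$. *)

theory Defs
  imports "HOL-Analysis.Analysis"
begin

section \<open>Complex Hilbert spaces\<close>

class complex_vector = real_vector +
  fixes scaleC :: "complex \<Rightarrow> 'a \<Rightarrow> 'a" (infixr "*\<^sub>C" 75)
  assumes scaleC_add_right: "a *\<^sub>C (x + y) = a *\<^sub>C x + a *\<^sub>C y"
    and scaleC_add_left: "(a + b) *\<^sub>C x = a *\<^sub>C x + b *\<^sub>C x"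
    and scaleC_scaleC: "a *\<^sub>C (b *\<^sub>C x) = (a * b) *\<^sub>C x"
    and scaleC_one: "1 *\<^sub>C x = x"
    and scaleR_scaleC: "r *\<^sub>R x = complex_of_real r *\<^sub>C x"

global_interpretation complex_vector: vector_space "scaleC :: complex \<Rightarrow> 'a \<Rightarrow> 'a :: complex_vector"
  defines cspan = complex_vector.span
  by unfold_locales (simp_all add: scaleC_add_right scaleC_add_left scaleC_scaleC scaleC_one)

text \<open>The inner product is conjugate-linear in its first argument.\<close>

class complex_inner = complex_vector + real_normed_vector +
  fixes cinner :: "'a \<Rightarrow> 'a \<Rightarrow> complex"
  assumes cinner_commute: "cinner x y = cnj (cinner y x)"
    and cinner_add_left: "cinner (x + y) z = cinner x z + cinner y z"
    and cinner_scaleC_left: "cinner (a *\<^sub>C x) y = cnj a * cinner x y"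
    and cinner_ge_zero: "0 \<le> Re (cinner x x)"
    and cinner_eq_zero_iff: "cinner x x = 0 \<longleftrightarrow> x = 0"
    and norm_eq_sqrt_cinner: "norm x = sqrt (cmod (cinner x x))"

class chilbert_space = complex_inner + complete_space

instantiation complex :: chilbert_space
begin

definition scaleC_complex :: "complex \<Rightarrow> complex \<Rightarrow> complex" where
  "scaleC_complex a x = a * x"

definition cinner_complex :: "complex \<Rightarrow> complex \<Rightarrow> complex" where
  "cinner_complex x y = cnj x * y"

instance
proof
  fix x y z a b :: complex and r :: real
  show "a *\<^sub>C (x + y) = a *\<^sub>C x + a *\<^sub>C y" "(a + b) *\<^sub>C x = a *\<^sub>C x + b *\<^sub>C x"
    "a *\<^sub>C (b *\<^sub>C x) = (a * b) *\<^sub>C x" "1 *\<^sub>C x = x" "r *\<^sub>R x = complex_of_real r *\<^sub>C x"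
    by (simp_all add: scaleC_complex_def algebra_simps scaleR_conv_of_real)
  show "cinner x y = cnj (cinner y x)" "cinner (x + y) z = cinner x z + cinner y z"
    "cinner (a *\<^sub>C x) y = cnj a * cinner x y" "0 \<le> Re (cinner x x)"
    "cinner x x = 0 \<longleftrightarrow> x = 0" "norm x = sqrt (cmod (cinner x x))"
    by (simp_all add: scaleC_complex_def cinner_complex_def algebra_simps norm_mult)
qed

end

section \<open>Bounded operators on a closed subspace\<close>

text \<open>
  In the following definitions M is a closed complex subspace of the ambient Hilbert space, regarded
  as a Hilbert space in its own right; an operator on M is a function on the ambient space of which
  only the values on M matter. For M = UNIV one obtains the operators on the whole space, and
  for M the range of a finite rank projection, the operators (matrices) on a finite dimensional
  space.
\<close>

definition bounded_op_on :: "'a::complex_inner set \<Rightarrow> ('a \<Rightarrow> 'a) \<Rightarrow> bool" where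
  "bounded_op_on M X \<longleftrightarrow>
     (\<forall>v\<in>M. X v \<in> M) \<and>
     (\<forall>v\<in>M. \<forall>w\<in>M. X (v + w) = X v + X w) \<and>
     (\<forall>c. \<forall>v\<in>M. X (c *\<^sub>C v) = c *\<^sub>C X v) \<and>
     (\<exists>K. \<forall>v\<in>M. norm (X v) \<le> K * norm v)"

lemma bounded_op_on_UNIV_iff:
  "bounded_op_on UNIV X \<longleftrightarrow> bounded_linear X \<and> (\<forall>c v. X (c *\<^sub>C v) = c *\<^sub>C X v)"
  unfolding bounded_op_on_def bounded_linear_def linear_iff bounded_linear_axioms_def
  by (auto simp: scaleR_scaleC mult.commute)

definition onorm_on :: "'a::complex_inner set \<Rightarrow> ('a \<Rightarrow> 'a) \<Rightarrow> real" where
  "onorm_on M X = (SUP v\<in>M. norm (X v) / norm v)"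

lemma onorm_on_UNIV: "onorm_on UNIV X = onorm X"
  by (simp add: onorm_on_def onorm_def)

definition is_inverse_on :: "'a::complex_inner set \<Rightarrow> ('a \<Rightarrow> 'a) \<Rightarrow> ('a \<Rightarrow> 'a) \<Rightarrow> bool" where
  "is_inverse_on M X Y \<longleftrightarrow> bounded_op_on M Y \<and> (\<forall>v\<in>M. Y (X v) = v \<and> X (Y v) = v)"

definition invertible_on :: "'a::complex_inner set \<Rightarrow> ('a \<Rightarrow> 'a) \<Rightarrow> bool" where
  "invertible_on M X \<longleftrightarrow> (\<exists>Y. is_inverse_on M X Y)"

text \<open>The norm of the inverse, with value \<open>\<infinity>\<close> if there is no inverse.\<close>

definition inverse_norm_on :: "'a::complex_inner set \<Rightarrow> ('a \<Rightarrow> 'a) \<Rightarrow> ennreal" where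
  "inverse_norm_on M X =
     (if invertible_on M X then ennreal (onorm_on M (SOME Y. is_inverse_on M X Y)) else \<infinity>)"

definition is_adjoint_on :: "'a::complex_inner set \<Rightarrow> ('a \<Rightarrow> 'a) \<Rightarrow> ('a \<Rightarrow> 'a) \<Rightarrow> bool" where
  "is_adjoint_on M X Y \<longleftrightarrow>
     bounded_op_on M Y \<and> (\<forall>v\<in>M. \<forall>w\<in>M. cinner (X v) w = cinner v (Y w))"

text \<open>Inverse and adjoint are determined on M, so the choices made by \<open>SOME\<close> do not matter.\<close>

lemma is_inverse_on_unique:
  assumes "is_inverse_on M X Y" "is_inverse_on M X Z" "v \<in> M"
  shows "Y v = Z v"
  using assms unfolding is_inverse_on_def bounded_op_on_def by metis

lemma is_adjoint_on_unique:
  assumes M: "complex_vector.subspace M" 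
    and Y: "is_adjoint_on M X Y" and Z: "is_adjoint_on M X Z" and w: "w \<in> M"
  shows "Y w = Z w"
proof -
  have d: "Y w - Z w \<in> M"
    using M Y Z w by (simp add: is_adjoint_on_def bounded_op_on_def complex_vector.subspace_diff)
  have add: "cinner v (a + b) = cinner v a + cinner v b" for v a b :: 'a
    by (metis cinner_commute cinner_add_left complex_cnj_add)
  have "cinner (Y w - Z w) (Z w + (Y w - Z w)) = cinner (Y w - Z w) (Z w)"
    using d Y Z w unfolding is_adjoint_on_def by (metis add_diff_cancel_left' add.commute diff_add_cancel)
  then show ?thesis
    by (simp only: add) (simp add: cinner_eq_zero_iff)
qed

definition adjoint_on :: "'a::complex_inner set \<Rightarrow> ('a \<Rightarrow> 'a) \<Rightarrow> 'a \<Rightarrow> 'a" where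
  "adjoint_on M X = (SOME Y. is_adjoint_on M X Y)"

section \<open>Spectral quantities\<close>

definition spectrum_on :: "'a::complex_inner set \<Rightarrow> ('a \<Rightarrow> 'a) \<Rightarrow> complex set" where
  "spectrum_on M X = {z. \<not> invertible_on M (\<lambda>v. z *\<^sub>C v - X v)}"

definition pseudospectrum_on :: "real \<Rightarrow> 'a::complex_inner set \<Rightarrow> ('a \<Rightarrow> 'a) \<Rightarrow> complex set" where
  "pseudospectrum_on \<epsilon> M X = {z. inverse_norm_on M (\<lambda>v. z *\<^sub>C v - X v) \<ge> ennreal (1 / \<epsilon>)}"

definition singular_values_on :: "'a::complex_inner set \<Rightarrow> ('a \<Rightarrow> 'a) \<Rightarrow> complex set" where
  "singular_values_on M X =
     {complex_of_real s | s. 0 \<le> s \<and> complex_of_real (s\<^sup>2) \<in> spectrum_on M (adjoint_on M X \<circ> X)}"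

section \<open>Projections, filtrations, quasidiagonality\<close>

definition orthogonal_projection :: "('a::complex_inner \<Rightarrow> 'a) \<Rightarrow> bool" where
  "orthogonal_projection P \<longleftrightarrow> bounded_op_on UNIV P \<and> is_adjoint_on UNIV P P \<and> P \<circ> P = P"

definition finite_rank :: "('a::complex_inner \<Rightarrow> 'a) \<Rightarrow> bool" where
  "finite_rank X \<longleftrightarrow> (\<exists>B. finite B \<and> range X \<subseteq> cspan B)"

definition filtration :: "(nat \<Rightarrow> 'a::complex_inner \<Rightarrow> 'a) \<Rightarrow> bool" where
  "filtration P \<longleftrightarrow>
     (\<forall>n. orthogonal_projection (P n) \<and> finite_rank (P n)) \<and>
     (\<forall>n. range (P n) \<subseteq> range (P (Suc n))) \<and>
     (\<forall>v. (\<lambda>n. norm (P n v - v)) \<longlonglongrightarrow> 0)"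

definition commutator :: "('a::complex_inner \<Rightarrow> 'a) \<Rightarrow> ('a \<Rightarrow> 'a) \<Rightarrow> 'a \<Rightarrow> 'a" where
  "commutator A B = (\<lambda>v. A (B v) - B (A v))"

definition quasidiagonal :: "('a::complex_inner \<Rightarrow> 'a) \<Rightarrow> bool" where
  "quasidiagonal T \<longleftrightarrow>
     (\<exists>Q. (\<forall>n::nat. orthogonal_projection (Q n) \<and> finite_rank (Q n)) \<and>
          (\<forall>v. (\<lambda>n. norm (Q n v - v)) \<longlonglongrightarrow> 0) \<and>
          (\<lambda>n. onorm (commutator T (Q n))) \<longlonglongrightarrow> 0)"

section \<open>Hausdorff convergence of compact sets\<close>

text \<open>
  With values in the extended nonnegative reals the suprema and infima are meaningful for empty sets
  as well: the distance between two empty sets is 0, and that between an empty and a nonempty set is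
  \<open>\<infinity>\<close>. Spectra are empty on the zero space, which is the range of a zero projection.
\<close>

definition hausdorff_dist :: "'a::metric_space set \<Rightarrow> 'a set \<Rightarrow> ennreal" where
  "hausdorff_dist S L =
     max (SUP x\<in>S. INF y\<in>L. ennreal (dist x y)) (SUP y\<in>L. INF x\<in>S. ennreal (dist y x))"

definition hausdorff_tendsto :: "(nat \<Rightarrow> 'a::metric_space set) \<Rightarrow> 'a set \<Rightarrow> bool" where
  "hausdorff_tendsto S L \<longleftrightarrow>
     (\<forall>n. compact (S n)) \<and> compact L \<and> (\<lambda>n. hausdorff_dist (S n) L) \<longlonglongrightarrow> 0"

definition hausdorff_lim :: "(nat \<Rightarrow> 'a::metric_space set) \<Rightarrow> 'a set" where
  "hausdorff_lim S = (THE L. hausdorff_tendsto S L)"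

end

theory Submission
  imports Defs
begin

text \<open>
  Since \<open>\<parallel>T v - P\<^sub>n T P\<^sub>n v\<parallel> \<le> \<parallel>[P\<^sub>n, T]\<parallel> \<parallel>v\<parallel>\<close> for \<open>v\<close> in the range of \<open>P\<^sub>n\<close>, lower bounds for \<open>z - T\<close> pass to
  the compressions, and approximate eigenvectors of \<open>T\<close> yield approximate eigenvectors of the compressions
  at the same \<open>z\<close>. Lower bounds suffice to describe all spectral quantities: in finite dimension and,
  by approximation, for \<open>T\<close>, an operator that is bounded below is invertible. The gap between strict and
  non-strict inequalities is closed by the fact that the resolvent norm of a Hilbert space operator is not
  locally constant where it equals \<open>1/\<epsilon>\<close>, and by compactness. For singular values the same argument applies
  to \<open>T\<^sup>* T\<close>; there approximate eigenvalues of the compressions give nearby true ones by symmetry.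
\<close>

section \<open>Complex inner product spaces\<close>

text \<open>A lower bound for \<open>z - T\<close> does not by itself give an inverse: the
  unilateral shift is isometric but not onto. Here surjectivity is forced by the compressions,
  because an injective square matrix is onto and the solutions of the compressed equations converge.
  With inverses eliminated, one perturbation inequality for lower bounds carries most of the
  argument. Two points need more. A vector survives compression only if it satisfies a strict
  inequality, but at a point where the infimum of |(z - T)v| / |v| equals \<epsilon> exactly there
  is no vector strictly below \<epsilon>; the point must be moved slightly, and finding a good
  direction uses the inner product. For singular values the level is 0: strict inequalities at level
  0 are impossible, and for a non-normal matrix a good approximate eigenvalue may be far from every
  eigenvalue. Self-adjointness of T* T repairs this. Since A* A for a compression A is not the
  compression of T* T, the limit results are stated for any operators on the ranges that approximate
  the limit operator with error tending to 0.\<close>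

context complex_inner begin

lemma cinner_add_right: "cinner x (y + z) = cinner x y + cinner x z"
  by (metis cinner_commute cinner_add_left complex_cnj_add)

lemma cinner_scaleC_right: "cinner x (a *\<^sub>C y) = a * cinner x y"
  by (metis cinner_commute cinner_scaleC_left complex_cnj_cnj complex_cnj_mult)

end

lemma scaleC_0_left [simp]: "0 *\<^sub>C (x::'a::complex_vector) = 0"
  by (rule complex_vector.scale_zero_left)

lemma scaleC_0_right [simp]: "a *\<^sub>C (0::'a::complex_vector) = 0"
  by (rule complex_vector.scale_zero_right)

lemma cinner_minus_left: "cinner (- x) y = - cinner x (y::'a::complex_inner)"
  using cinner_scaleC_left[of "-1" x y] by (simp add: scaleC_one)

lemma cinner_minus_right: "cinner x (- y) = - cinner x (y::'a::complex_inner)"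
  using cinner_scaleC_right[of x "-1" y] by (simp add: scaleC_one)

lemma cinner_diff_left: "cinner (x - y) z = cinner x z - cinner y (z::'a::complex_inner)"
  using cinner_add_left[of x "- y" z] by (simp add: cinner_minus_left)

lemma cinner_diff_right: "cinner x (y - z) = cinner x y - cinner x (z::'a::complex_inner)"
  using cinner_add_right[of x y "- z"] by (simp add: cinner_minus_right)

lemmas cinner_simps = cinner_add_left cinner_add_right cinner_diff_left cinner_diff_right
  cinner_scaleC_left cinner_scaleC_right

lemma cinner_self: "cinner x x = complex_of_real ((norm (x::'a::complex_inner))\<^sup>2)"
proof -
  have "Im (cinner x x) = 0"
    using cinner_commute[of x x] by (metis complex_cnj_cancel_iff Reals_cnj_iff complex_is_Real_iff)
  then have "cinner x x = complex_of_real (Re (cinner x x))"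
    by (simp add: complex_eq_iff)
  moreover from this have "cmod (cinner x x) = Re (cinner x x)"
    using cinner_ge_zero[of x] by (metis abs_of_nonneg norm_of_real)
  ultimately show ?thesis
    using norm_eq_sqrt_cinner[of x] by (metis norm_ge_zero real_sqrt_pow2)
qed

lemma Re_cinner_commute: "Re (cinner x y) = Re (cinner y (x::'a::complex_inner))"
  by (subst cinner_commute) simp

lemma norm_add_sq:
  "(norm (x + y))\<^sup>2 = (norm x)\<^sup>2 + 2 * Re (cinner x y) + (norm (y::'a::complex_inner))\<^sup>2"
proof -
  have "complex_of_real ((norm (x + y))\<^sup>2) = cinner x x + cinner x y + cinner y x + cinner y y"
    by (simp only: cinner_self[symmetric] cinner_simps) simp
  from arg_cong[OF this, of Re] show ?thesis
    by (simp add: cinner_self Re_cinner_commute[of y x])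
qed

lemma norm_diff_sq:
  "(norm (x - y))\<^sup>2 = (norm x)\<^sup>2 - 2 * Re (cinner x y) + (norm (y::'a::complex_inner))\<^sup>2"
  using norm_add_sq[of x "- y"] by (simp add: cinner_minus_right)

lemma parallelogram_law:
  "(norm (x + y))\<^sup>2 + (norm (x - y))\<^sup>2 = 2 * (norm x)\<^sup>2 + 2 * (norm (y::'a::complex_inner))\<^sup>2"
  by (simp add: norm_add_sq norm_diff_sq)

lemma norm_scaleC: "norm (a *\<^sub>C x) = cmod a * norm (x::'a::complex_inner)"
proof -
  have "complex_of_real ((norm (a *\<^sub>C x))\<^sup>2) = complex_of_real ((cmod a * norm x)\<^sup>2)"
    by (simp only: cinner_self[symmetric] cinner_simps)
       (simp add: cinner_self power_mult_distrib complex_norm_square[of a] mult_ac flip: of_real_power)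
  then have "(norm (a *\<^sub>C x))\<^sup>2 = (cmod a * norm x)\<^sup>2"
    by (simp only: of_real_eq_iff)
  then show ?thesis
    by (rule power2_eq_imp_eq) simp_all
qed

lemma Re_cinner_le: "Re (cinner x y) \<le> norm x * norm (y::'a::complex_inner)"
proof (cases "x = 0 \<or> y = 0")
  case True
  then show ?thesis
    using cinner_scaleC_left[of 0 x y] cinner_scaleC_right[of x 0 y] by auto
next
  case False
  define a b where "a = norm x" and "b = norm y"
  have pos: "a > 0" "b > 0"
    using False by (auto simp: a_def b_def)
  \<comment> \<open>Both vectors are scaled to the common length \<open>a * b\<close>, so that the
    expansion contains the factor \<open>a * b - Re (cinner x y)\<close>.\<close>
  have "0 \<le> (norm (complex_of_real b *\<^sub>C x - complex_of_real a *\<^sub>C y))\<^sup>2"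
    by simp
  also have "\<dots> = 2 * (a * b) * (a * b - Re (cinner x y))"
    using pos by (simp add: norm_diff_sq norm_scaleC cinner_simps flip: a_def b_def)
      (simp add: power2_eq_square algebra_simps)
  finally have "0 \<le> a * b - Re (cinner x y)"
    using pos by (metis mult_pos_pos zero_le_mult_iff not_less zero_less_numeral)
  then show ?thesis
    by (simp add: a_def b_def)
qed

lemma cmod_cinner_le: "cmod (cinner x y) \<le> norm x * norm (y::'a::complex_inner)"
proof (cases "cinner x y = 0")
  case False
  define u where "u = cnj (cinner x y) / complex_of_real (cmod (cinner x y))"
  have "cmod u = 1"
    using False by (simp add: u_def norm_divide)
  have "u * cinner x y = complex_of_real (cmod (cinner x y))"
    using False by (simp add: u_def field_simps complex_norm_square[symmetric] power2_eq_square)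
  then have "cmod (cinner x y) = Re (cinner x (u *\<^sub>C y))"
    by (simp add: cinner_simps)
  also have "\<dots> \<le> norm x * norm (u *\<^sub>C y)"
    by (rule Re_cinner_le)
  finally show ?thesis
    using \<open>cmod u = 1\<close> by (simp add: norm_scaleC)
qed simp

section \<open>Bounded operators and lower bounds\<close>

lemma bounded_op_onD:
  assumes "bounded_op_on M X"
  shows "v \<in> M \<Longrightarrow> X v \<in> M"
    and "v \<in> M \<Longrightarrow> w \<in> M \<Longrightarrow> X (v + w) = X v + X w"
    and "v \<in> M \<Longrightarrow> X (c *\<^sub>C v) = c *\<^sub>C X v"
  using assms by (auto simp: bounded_op_on_def)

lemma bounded_op_on_diff:
  assumes "complex_vector.subspace M" "bounded_op_on M X" "v \<in> M" "w \<in> M"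
  shows "X (v - w) = X v - X w"
proof -
  have "v - w \<in> M"
    using assms by (simp add: complex_vector.subspace_diff)
  with assms bounded_op_onD(2)[of M X "v - w" w] show ?thesis
    by (simp add: algebra_simps)
qed

lemma bounded_op_on_zero:
  assumes "complex_vector.subspace M" "bounded_op_on M X"
  shows "X 0 = 0"
  using bounded_op_on_diff[OF assms, of 0 0] assms by (simp add: complex_vector.subspace_0)

lemma bounded_op_on_bound:
  assumes "bounded_op_on M X"
  obtains K where "K > 0" "\<And>v. v \<in> M \<Longrightarrow> norm (X v) \<le> K * norm v"
proof -
  obtain K where K: "\<forall>v\<in>M. norm (X v) \<le> K * norm v"
    using assms by (auto simp: bounded_op_on_def)
  have "norm (X v) \<le> (\<bar>K\<bar> + 1) * norm v" if "v \<in> M" for v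
    using K that by (smt (verit) mult_right_mono norm_ge_zero)
  then show ?thesis
    by (intro that[of "\<bar>K\<bar> + 1"]) auto
qed

lemma bounded_op_on_UNIV_bound:
  assumes "bounded_op_on UNIV X"
  obtains K where "K > 0" "\<And>v. norm (X v) \<le> K * norm v"
proof -
  obtain K where "K > 0" "\<And>v. v \<in> UNIV \<Longrightarrow> norm (X v) \<le> K * norm v"
    using bounded_op_on_bound[OF assms] by blast
  then show ?thesis
    by (intro that[of K]) auto
qed

lemma bounded_op_on_shift:
  assumes M: "complex_vector.subspace M" and X: "bounded_op_on M X"
  shows "bounded_op_on M (\<lambda>v. z *\<^sub>C v - X v)"
proof -
  obtain K where K: "\<And>v. v \<in> M \<Longrightarrow> norm (X v) \<le> K * norm v"
    using bounded_op_on_bound[OF X] by blast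
  have "norm (z *\<^sub>C v - X v) \<le> (cmod z + K) * norm v" if "v \<in> M" for v
    using norm_triangle_ineq4[of "z *\<^sub>C v" "X v"] K[OF that] by (simp add: norm_scaleC algebra_simps)
  then show ?thesis
    unfolding bounded_op_on_def
    using M bounded_op_onD[OF X]
    by (auto simp: complex_vector.subspace_diff complex_vector.subspace_scale scaleC_add_right
        complex_vector.scale_right_diff_distrib complex_vector.scale_left_commute intro!: exI[of _ "cmod z + K"])
qed

lemma bounded_op_on_comp:
  assumes X: "bounded_op_on M X" and Y: "bounded_op_on M Y"
  shows "bounded_op_on M (X \<circ> Y)"
proof -
  obtain K where K: "K > 0" "\<And>v. v \<in> M \<Longrightarrow> norm (X v) \<le> K * norm v"
    using bounded_op_on_bound[OF X] by blast
  obtain L where L: "L > 0" "\<And>v. v \<in> M \<Longrightarrow> norm (Y v) \<le> L * norm v"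
    using bounded_op_on_bound[OF Y] by blast
  have "norm (X (Y v)) \<le> K * L * norm v" if "v \<in> M" for v
  proof -
    have "norm (X (Y v)) \<le> K * norm (Y v)"
      using K(2) bounded_op_onD(1)[OF Y that] by blast
    also have "\<dots> \<le> K * (L * norm v)"
      using K(1) L(2)[OF that] by (intro mult_left_mono) auto
    finally show ?thesis by (simp add: mult.assoc)
  qed
  then show ?thesis
    unfolding bounded_op_on_def using bounded_op_onD[OF X] bounded_op_onD[OF Y] by auto
qed

section \<open>Lower bounds and the approximate pseudospectra that they define\<close>

definition lower_bound_on :: "'a::complex_inner set \<Rightarrow> ('a \<Rightarrow> 'a) \<Rightarrow> real \<Rightarrow> bool" where
  "lower_bound_on M X c \<longleftrightarrow> (\<forall>v\<in>M. c * norm v \<le> norm (X v))"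

lemma lower_bound_onI: "(\<And>v. v \<in> M \<Longrightarrow> c * norm v \<le> norm (X v)) \<Longrightarrow> lower_bound_on M X c"
  by (simp add: lower_bound_on_def)

lemma lower_bound_onD: "lower_bound_on M X c \<Longrightarrow> v \<in> M \<Longrightarrow> c * norm v \<le> norm (X v)"
  by (simp add: lower_bound_on_def)

text \<open>For \<open>\<epsilon> = 0\<close> this is the approximate point spectrum.\<close>

definition approx_pseudospectrum_on :: "real \<Rightarrow> 'a::complex_inner set \<Rightarrow> ('a \<Rightarrow> 'a) \<Rightarrow> complex set" where
  "approx_pseudospectrum_on \<epsilon> M X = {z. \<nexists>c. c > \<epsilon> \<and> lower_bound_on M (\<lambda>v. z *\<^sub>C v - X v) c}"

text \<open>A lower bound \<open>c > 0\<close> already excludes the point at level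
  \<open>c / 2\<close>. This yields the intersection formula for the spectrum of
  \<open>T\<close>.\<close>

lemma approx_pseudospectrum_zero:
  "approx_pseudospectrum_on 0 M X = (\<Inter>\<epsilon>\<in>{0<..}. approx_pseudospectrum_on \<epsilon> M X)"
proof (intro equalityI subsetI INT_I)
  fix z \<epsilon> assume "z \<in> approx_pseudospectrum_on 0 M X" "\<epsilon> \<in> {0::real<..}"
  then show "z \<in> approx_pseudospectrum_on \<epsilon> M X"
    unfolding approx_pseudospectrum_on_def by (auto dest: less_trans)
next
  fix z assume z: "z \<in> (\<Inter>\<epsilon>\<in>{0<..}. approx_pseudospectrum_on \<epsilon> M X)"
  have "\<not> lower_bound_on M (\<lambda>v. z *\<^sub>C v - X v) c" if "c > 0" for c
  proof -
    have "z \<in> approx_pseudospectrum_on (c / 2) M X"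
      using z that by simp
    then show ?thesis
      using that unfolding approx_pseudospectrum_on_def by auto
  qed
  then show "z \<in> approx_pseudospectrum_on 0 M X"
    by (simp add: approx_pseudospectrum_on_def)
qed

text \<open>The triangle inequality, with three changes at once: the point moves from
  \<open>z\<close> to \<open>w\<close>, the operator changes from \<open>X\<close> to
  \<open>Y\<close>, the domain shrinks from \<open>N\<close> to \<open>M\<close>. The case
  \<open>d = 0\<close> gives closedness of pseudospectra; the general case compares an operator with
  its compressions.\<close>

lemma lower_bound_on_perturb:
  assumes "lower_bound_on N (\<lambda>v. z *\<^sub>C v - X v) c" and "M \<subseteq> N"
    and "\<And>v. v \<in> M \<Longrightarrow> norm (X v - Y v) \<le> d * norm v"
  shows "lower_bound_on M (\<lambda>v. w *\<^sub>C v - Y v) (c - dist w z - d)"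
proof (rule lower_bound_onI)
  fix v assume "v \<in> M"
  have "z *\<^sub>C v - X v = (w *\<^sub>C v - Y v) + ((z - w) *\<^sub>C v - (X v - Y v))"
    by (simp add: complex_vector.scale_left_diff_distrib)
  then have "norm (z *\<^sub>C v - X v) \<le> norm (w *\<^sub>C v - Y v) + (norm ((z - w) *\<^sub>C v) + norm (X v - Y v))"
    by (metis norm_triangle_mono norm_triangle_ineq4 order_refl)
  moreover have "norm ((z - w) *\<^sub>C v) = dist w z * norm v"
    by (simp add: norm_scaleC dist_norm norm_minus_commute)
  moreover have "c * norm v \<le> norm (z *\<^sub>C v - X v)"
    using assms \<open>v \<in> M\<close> by (auto dest: lower_bound_onD)
  ultimately show "(c - dist w z - d) * norm v \<le> norm (w *\<^sub>C v - Y v)"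
    using assms(3)[OF \<open>v \<in> M\<close>] by (simp add: algebra_simps)
qed

lemma closed_approx_pseudospectrum: "closed (approx_pseudospectrum_on \<epsilon> M X)"
  unfolding closed_def open_dist
proof
  fix z assume "z \<in> - approx_pseudospectrum_on \<epsilon> M X"
  then obtain c where c: "c > \<epsilon>" "lower_bound_on M (\<lambda>v. z *\<^sub>C v - X v) c"
    by (auto simp: approx_pseudospectrum_on_def)
  have "w \<in> - approx_pseudospectrum_on \<epsilon> M X" if "dist w z < c - \<epsilon>" for w
  proof -
    have "lower_bound_on M (\<lambda>v. w *\<^sub>C v - X v) (c - dist w z)"
      using lower_bound_on_perturb[OF c(2) order_refl, of X 0 w] by simp
    then show ?thesis
      using that unfolding approx_pseudospectrum_on_def by (auto intro!: exI[of _ "c - dist w z"])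
  qed
  then show "\<exists>e>0. \<forall>w. dist w z < e \<longrightarrow> w \<in> - approx_pseudospectrum_on \<epsilon> M X"
    using c(1) by (intro exI[of _ "c - \<epsilon>"]) auto
qed

lemma approx_pseudospectrum_subset_cball:
  assumes "\<And>v. v \<in> M \<Longrightarrow> norm (X v) \<le> K * norm v"
  shows "approx_pseudospectrum_on \<epsilon> M X \<subseteq> cball 0 (K + \<epsilon>)"
proof
  fix z assume z: "z \<in> approx_pseudospectrum_on \<epsilon> M X"
  have "lower_bound_on M (\<lambda>v. z *\<^sub>C v - X v) (cmod z - K)"
  proof (rule lower_bound_onI)
    fix v assume "v \<in> M"
    then show "(cmod z - K) * norm v \<le> norm (z *\<^sub>C v - X v)"
      using norm_triangle_ineq2[of "z *\<^sub>C v" "X v"] assms[of v] by (simp add: norm_scaleC algebra_simps)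
  qed
  then show "z \<in> cball 0 (K + \<epsilon>)"
    using z unfolding approx_pseudospectrum_on_def by (force simp: not_less)
qed

lemma compact_approx_pseudospectrum:
  assumes "bounded_op_on M X"
  shows "compact (approx_pseudospectrum_on \<epsilon> M X)"
proof -
  obtain K where "\<And>v. v \<in> M \<Longrightarrow> norm (X v) \<le> K * norm v"
    using bounded_op_on_bound[OF assms] by blast
  from approx_pseudospectrum_subset_cball[OF this] show ?thesis
    by (meson bounded_cball bounded_subset closed_approx_pseudospectrum compact_eq_bounded_closed)
qed

section \<open>From lower bounds to inverses and spectra\<close>

lemma lower_bound_on_inj:
  assumes M: "complex_vector.subspace M" and X: "bounded_op_on M X"
    and c: "c > 0" "lower_bound_on M X c"
  shows "inj_on X M"
proof (rule inj_onI)
  fix v w assume vw: "v \<in> M" "w \<in> M" "X v = X w"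
  then have "X (v - w) = 0"
    using bounded_op_on_diff[OF M X] by simp
  moreover have "v - w \<in> M"
    using vw M by (simp add: complex_vector.subspace_diff)
  ultimately have "c * norm (v - w) \<le> 0"
    using lower_bound_onD[OF c(2)] by fastforce
  then show "v = w"
    using c(1) by (simp add: mult_le_0_iff)
qed

lemma is_inverse_on_norm_le:
  assumes "is_inverse_on M X Y" "lower_bound_on M X c" "c > 0" "v \<in> M"
  shows "norm (Y v) \<le> norm v / c"
proof -
  have "c * norm (Y v) \<le> norm (X (Y v))"
    using assms by (intro lower_bound_onD) (auto simp: is_inverse_on_def bounded_op_on_def)
  moreover have "X (Y v) = v"
    using assms by (simp add: is_inverse_on_def)
  ultimately show ?thesis
    using assms(3) by (simp add: field_simps)
qed

text \<open>The lower bound gives both injectivity and the bound \<open>1 / c\<close> for the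
  inverse, so no open mapping theorem is involved.\<close>

lemma invertible_onI:
  assumes M: "complex_vector.subspace M" and X: "bounded_op_on M X"
    and c: "c > 0" "lower_bound_on M X c" and surj: "M \<subseteq> X ` M"
  shows "invertible_on M X"
proof -
  define Y where "Y = inv_into M X"
  have inj: "inj_on X M"
    by (rule lower_bound_on_inj[OF M X c])
  have Y: "Y v \<in> M" "X (Y v) = v" if "v \<in> M" for v
    using that surj by (auto simp: Y_def inv_into_into f_inv_into_f subset_iff)
  have YX: "Y (X v) = v" if "v \<in> M" for v
    using inj that by (simp add: Y_def)
  have "Y (v + w) = Y v + Y w" if "v \<in> M" "w \<in> M" for v w
  proof -
    have "Y v + Y w \<in> M" "X (Y v + Y w) = v + w"
      using that M Y bounded_op_onD(2)[OF X] by (auto simp: complex_vector.subspace_add)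
    then show ?thesis by (metis YX)
  qed
  moreover have "Y (a *\<^sub>C v) = a *\<^sub>C Y v" if "v \<in> M" for a v
  proof -
    have "a *\<^sub>C Y v \<in> M" "X (a *\<^sub>C Y v) = a *\<^sub>C v"
      using that M Y bounded_op_onD(3)[OF X] by (auto simp: complex_vector.subspace_scale)
    then show ?thesis by (metis YX)
  qed
  moreover have "norm (Y v) \<le> (1 / c) * norm v" if "v \<in> M" for v
    using lower_bound_onD[OF c(2) Y(1)[OF that]] c(1) Y(2)[OF that] by (simp add: field_simps)
  ultimately have "bounded_op_on M Y"
    using Y unfolding bounded_op_on_def by blast
  then show ?thesis
    using Y YX by (auto simp: invertible_on_def is_inverse_on_def)
qed

lemma is_inverse_on_lower_bound:
  assumes "is_inverse_on M X Y" and X: "\<And>v. v \<in> M \<Longrightarrow> X v \<in> M"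
    and "K > 0" and K: "\<And>v. v \<in> M \<Longrightarrow> norm (Y v) \<le> K * norm v"
  shows "lower_bound_on M X (1 / K)"
proof (rule lower_bound_onI)
  fix v assume "v \<in> M"
  then have "norm v \<le> K * norm (X v)"
    using assms(1) K[OF X, of v] by (simp add: is_inverse_on_def)
  then show "1 / K * norm v \<le> norm (X v)"
    using \<open>K > 0\<close> by (simp add: field_simps)
qed

lemma onorm_on_bound:
  assumes M: "complex_vector.subspace M" and X: "bounded_op_on M X" and v: "v \<in> M"
  shows "norm (X v) \<le> onorm_on M X * norm v"
proof -
  obtain K where K: "K > 0" "\<And>v. v \<in> M \<Longrightarrow> norm (X v) \<le> K * norm v"
    using bounded_op_on_bound[OF X] by blast
  \<comment> \<open>At \<open>w = 0\<close> the quotient is 0 by convention; boundedness of the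
    quotients makes the supremum of reals meaningful.\<close>
  have "norm (X w) / norm w \<le> K" if "w \<in> M" for w
    using K that by (cases "w = 0") (auto simp: field_simps)
  then have "norm (X v) / norm v \<le> onorm_on M X"
    unfolding onorm_on_def using v by (intro cSUP_upper bdd_aboveI2) auto
  then show ?thesis
    using bounded_op_on_zero[OF M X] by (cases "v = 0") (auto simp: field_simps)
qed

lemma onorm_on_le:
  assumes "M \<noteq> {}" "K \<ge> 0" "\<And>v. v \<in> M \<Longrightarrow> norm (X v) \<le> K * norm v"
  shows "onorm_on M X \<le> K"
  unfolding onorm_on_def
proof (rule cSUP_least)
  fix v assume "v \<in> M"
  then show "norm (X v) / norm v \<le> K"
    using assms by (cases "v = 0") (auto simp: field_simps)
qed (use assms in auto)

text \<open>On the spaces and operators considered below, an operator that is bounded below is invertible,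
  so that only lower bounds of \<open>z - X\<close> need to be studied.\<close>

definition bounded_below_invertible :: "'a::complex_inner set \<Rightarrow> ('a \<Rightarrow> 'a) \<Rightarrow> bool" where
  "bounded_below_invertible M X \<longleftrightarrow>
     (\<forall>z c. c > 0 \<longrightarrow> lower_bound_on M (\<lambda>v. z *\<^sub>C v - X v) c \<longrightarrow> invertible_on M (\<lambda>v. z *\<^sub>C v - X v))"

text \<open>A bounded inverse forces a positive lower bound; the converse is
  \<open>bounded_below_invertible\<close>, which says that failure of surjectivity alone never
  produces a spectral point.\<close>

lemma spectrum_on_eq:
  assumes M: "complex_vector.subspace M" and X: "bounded_op_on M X"
    and inv: "bounded_below_invertible M X"
  shows "spectrum_on M X = approx_pseudospectrum_on 0 M X"
proof -
  have "\<exists>c>0. lower_bound_on M (\<lambda>v. z *\<^sub>C v - X v) c" if invz: "invertible_on M (\<lambda>v. z *\<^sub>C v - X v)" for z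
  proof -
    obtain Y where Y: "is_inverse_on M (\<lambda>v. z *\<^sub>C v - X v) Y"
      using invz by (auto simp: invertible_on_def)
    then obtain K where "K > 0" "\<And>v. v \<in> M \<Longrightarrow> norm (Y v) \<le> K * norm v"
      using bounded_op_on_bound unfolding is_inverse_on_def by blast
    with is_inverse_on_lower_bound[OF Y bounded_op_onD(1)[OF bounded_op_on_shift[OF M X]]]
    show ?thesis by (metis zero_less_divide_1_iff)
  qed
  then show ?thesis
    using inv by (auto simp: spectrum_on_def approx_pseudospectrum_on_def bounded_below_invertible_def)
qed

lemma pseudospectrum_on_eq:
  assumes M: "complex_vector.subspace M" and X: "bounded_op_on M X"
    and inv: "bounded_below_invertible M X" and \<epsilon>: "\<epsilon> > 0"
  shows "pseudospectrum_on \<epsilon> M X = approx_pseudospectrum_on \<epsilon> M X"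
proof -
  have "ennreal (1 / \<epsilon>) \<le> inverse_norm_on M (\<lambda>v. z *\<^sub>C v - X v) \<longleftrightarrow>
      \<not> (\<exists>c>\<epsilon>. lower_bound_on M (\<lambda>v. z *\<^sub>C v - X v) c)" (is "?l \<longleftrightarrow> \<not> ?r") for z
  proof (cases "invertible_on M (\<lambda>v. z *\<^sub>C v - X v)")
    case False
    then have "\<not> ?r"
      using inv \<epsilon> unfolding bounded_below_invertible_def by (meson less_trans)
    with False show ?thesis
      by (simp add: inverse_norm_on_def)
  next
    case True
    define X' Y where "X' = (\<lambda>v. z *\<^sub>C v - X v)" and "Y = (SOME Y. is_inverse_on M X' Y)"
    have Y: "is_inverse_on M X' Y"
      using True unfolding Y_def X'_def invertible_on_def by (rule someI_ex)
    have bY: "bounded_op_on M Y"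
      using Y by (simp add: is_inverse_on_def)
    have "inverse_norm_on M X' = ennreal (onorm_on M Y)"
      using True by (simp add: inverse_norm_on_def Y_def X'_def)
    moreover have "\<not> 1 / \<epsilon> \<le> onorm_on M Y \<longleftrightarrow> (\<exists>c>\<epsilon>. lower_bound_on M X' c)"
    proof safe
      assume "\<not> 1 / \<epsilon> \<le> onorm_on M Y"
      \<comment> \<open>\<open>K\<close> must be positive to be inverted, whereas the norm of
        \<open>Y\<close> is 0 on the zero space; hence the maximum with 0.\<close>
      then obtain K where K: "max 0 (onorm_on M Y) < K" "K < 1 / \<epsilon>"
        using dense[of "max 0 (onorm_on M Y)" "1 / \<epsilon>"] \<epsilon> by auto
      have "norm (Y v) \<le> K * norm v" if "v \<in> M" for v
        using onorm_on_bound[OF M bY that] K(1) by (smt (verit) mult_right_mono norm_ge_zero)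
      then have "lower_bound_on M X' (1 / K)"
        using K(1) bounded_op_onD(1)[OF bounded_op_on_shift[OF M X]]
        by (intro is_inverse_on_lower_bound[OF Y]) (auto simp: X'_def)
      moreover have "1 / K > \<epsilon>"
        using K \<epsilon> by (simp add: field_simps)
      ultimately show "\<exists>c>\<epsilon>. lower_bound_on M X' c" by blast
    next
      fix c assume c: "c > \<epsilon>" "lower_bound_on M X' c" and le: "1 / \<epsilon> \<le> onorm_on M Y"
      have "onorm_on M Y \<le> 1 / c"
        using is_inverse_on_norm_le[OF Y c(2)] c(1) \<epsilon> complex_vector.subspace_0[OF M]
        by (intro onorm_on_le) auto
      moreover have "1 / c < 1 / \<epsilon>"
        using c(1) \<epsilon> by (simp add: frac_less2)
      ultimately show False
        using le by simp
    qed
    moreover have "ennreal (1 / \<epsilon>) \<le> ennreal k \<longleftrightarrow> 1 / \<epsilon> \<le> k" for k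
      using \<epsilon> divide_pos_pos[of 1 \<epsilon>] unfolding ennreal_le_iff2 by linarith
    ultimately show ?thesis
      by (auto simp: X'_def)
  qed
  then show ?thesis
    by (auto simp: pseudospectrum_on_def approx_pseudospectrum_on_def)
qed

text \<open>A quantitative maximum principle: if the resolvent norm were at most
  \<open>1 / \<epsilon>\<close> on a whole disc, it would be strictly smaller at the centre. The
  identity \<open>(A + h) (A - h) = A\<^sup>2 - h\<^sup>2\<close> replaces the power series of the
  resolvent. The inner product is essential, since on a Banach space the resolvent norm can be
  constant on an open set.\<close>

lemma resolvent_norm_not_locally_constant:
  fixes X :: "'a::complex_inner \<Rightarrow> 'a"
  assumes X: "bounded_op_on UNIV X" and inv: "bounded_below_invertible UNIV X" and \<epsilon>: "\<epsilon> > 0"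
    and z: "z \<in> approx_pseudospectrum_on \<epsilon> UNIV X" and r: "r > 0"
  shows "\<exists>w v. dist w z < r \<and> norm (w *\<^sub>C v - X v) < \<epsilon> * norm v"
proof (rule ccontr)
  assume "\<not> ?thesis"
  then have lower: "\<epsilon> * norm v \<le> norm (w *\<^sub>C v - X v)" if "dist w z < r" for w v
    using that by (meson not_less)
  define A where "A = (\<lambda>v. z *\<^sub>C v - X v)"
  have A: "bounded_op_on UNIV A"
    unfolding A_def by (rule bounded_op_on_shift[OF complex_vector.subspace_UNIV X])
  obtain K where K: "K > 0" "\<And>v. norm (A v) \<le> K * norm v"
    using bounded_op_on_UNIV_bound[OF A] by metis
  have "lower_bound_on UNIV A \<epsilon>"
    using lower[of z] r by (auto simp: A_def intro: lower_bound_onI)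
  then have "invertible_on UNIV A"
    using inv \<epsilon> by (simp add: A_def bounded_below_invertible_def)
  then have surj: "\<exists>x. y = A x" for y
    unfolding invertible_on_def is_inverse_on_def by (metis UNIV_I)
  \<comment> \<open>\<open>t < r\<close> keeps the points \<open>z + h\<close> with
    \<open>cmod h = t\<close> inside the disc, and \<open>t < \<epsilon>\<close> makes the gain
    \<open>t\<^sup>2 * (\<epsilon>\<^sup>2 - t\<^sup>2)\<close> positive.\<close>
  define t where "t = min (r / 2) (\<epsilon> / 2)"
  have t: "t > 0" "t < r" "t < \<epsilon>"
    using r \<epsilon> by (auto simp: t_def)
  then have t\<epsilon>: "t\<^sup>2 < \<epsilon>\<^sup>2"
    by (intro power_strict_mono) auto
  \<comment> \<open>The averaging gains a multiple of \<open>(norm x)\<^sup>2\<close>; dividing by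
    \<open>K\<^sup>2\<close> turns it into a gain in terms of \<open>(norm (A x))\<^sup>2\<close>.
    As \<open>A\<close> is onto, \<open>A x\<close> is then an arbitrary vector.\<close>
  define \<eta> where "\<eta> = t\<^sup>2 * (\<epsilon>\<^sup>2 - t\<^sup>2) / K\<^sup>2"
  have \<eta>: "\<eta> > 0"
    using t K(1) t\<epsilon> by (simp add: \<eta>_def)
  have key: "(\<epsilon>\<^sup>2 + \<eta>) * (norm (A x))\<^sup>2 \<le> (norm (A (A x)))\<^sup>2" for x
  proof -
    define a b q where "a = (norm (A x))\<^sup>2" and "b = (norm x)\<^sup>2" and "q = (norm (A (A x)))\<^sup>2"
    define p s where "p = cinner (A x) x" and "s = cinner (A (A x)) x"
    text \<open>The lower bound at \<open>z + h\<close>, applied to the vector \<open>A x - h x\<close>; averaging over the four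
      values of \<open>h\<close> cancels the mixed terms.\<close>
    have h: "\<epsilon>\<^sup>2 * (a - 2 * Re (h * p) + t\<^sup>2 * b) \<le> q - 2 * Re (h\<^sup>2 * s) + t^4 * b"
      if h: "cmod h = t" for h
    proof -
      have "(z + h) *\<^sub>C v - X v = A v + h *\<^sub>C v" for v
        by (simp add: A_def scaleC_add_left)
      moreover have "A (A x - h *\<^sub>C x) = A (A x) - h *\<^sub>C A x"
        using bounded_op_on_diff[OF complex_vector.subspace_UNIV A] bounded_op_onD(3)[OF A] by simp
      ultimately have "(z + h) *\<^sub>C (A x - h *\<^sub>C x) - X (A x - h *\<^sub>C x) = A (A x) - h\<^sup>2 *\<^sub>C x"
        by (simp only:) (simp add: complex_vector.scale_right_diff_distrib scaleC_scaleC power2_eq_square)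
      moreover have "dist (z + h) z < r"
        using t h by (simp add: dist_norm)
      ultimately have "\<epsilon> * norm (A x - h *\<^sub>C x) \<le> norm (A (A x) - h\<^sup>2 *\<^sub>C x)"
        using lower[of "z + h" "A x - h *\<^sub>C x"] by simp
      then have "(\<epsilon> * norm (A x - h *\<^sub>C x))\<^sup>2 \<le> (norm (A (A x) - h\<^sup>2 *\<^sub>C x))\<^sup>2"
        using \<epsilon> by (intro power_mono) auto
      moreover have "(norm (A x - h *\<^sub>C x))\<^sup>2 = a - 2 * Re (h * p) + t\<^sup>2 * b"
        by (simp add: norm_diff_sq norm_scaleC cinner_simps h a_def b_def p_def power_mult_distrib)
      moreover have "(norm (A (A x) - h\<^sup>2 *\<^sub>C x))\<^sup>2 = q - 2 * Re (h\<^sup>2 * s) + t^4 * b"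
        by (simp add: norm_diff_sq norm_scaleC cinner_simps h q_def b_def s_def power_mult_distrib
            norm_power)
      ultimately show ?thesis
        by (simp add: power_mult_distrib)
    qed
    \<comment> \<open>The values of \<open>h\<close> are t, -t, it and -it. They sum to 0, and so do
      their squares, which removes both \<open>p\<close> and \<open>s\<close>.\<close>
    have "4 * (\<epsilon>\<^sup>2 * (a + t\<^sup>2 * b)) \<le> 4 * (q + t^4 * b)"
    proof -
      have "Re ((complex_of_real t)\<^sup>2 * s) = t\<^sup>2 * Re s"
        by (simp flip: of_real_power)
      then have "\<epsilon>\<^sup>2 * (a - 2 * (t * Re p) + t\<^sup>2 * b) \<le> q - 2 * (t\<^sup>2 * Re s) + t^4 * b"
        "\<epsilon>\<^sup>2 * (a - 2 * (- t * Re p) + t\<^sup>2 * b) \<le> q - 2 * (t\<^sup>2 * Re s) + t^4 * b"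
        "\<epsilon>\<^sup>2 * (a - 2 * (- t * Im p) + t\<^sup>2 * b) \<le> q - 2 * (- t\<^sup>2 * Re s) + t^4 * b"
        "\<epsilon>\<^sup>2 * (a - 2 * (t * Im p) + t\<^sup>2 * b) \<le> q - 2 * (- t\<^sup>2 * Re s) + t^4 * b"
        using h[of "complex_of_real t"] h[of "- complex_of_real t"]
          h[of "\<i> * complex_of_real t"] h[of "- (\<i> * complex_of_real t)"] t(1)
        by (simp_all add: norm_mult power_mult_distrib)
      then show ?thesis
        by (simp add: algebra_simps)
    qed
    then have le: "\<epsilon>\<^sup>2 * a + t\<^sup>2 * (\<epsilon>\<^sup>2 - t\<^sup>2) * b \<le> q"
      by (simp add: algebra_simps power4_eq_xxxx power2_eq_square)
    have "a \<le> (K * norm x)\<^sup>2"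
      unfolding a_def using K(2) by (intro power_mono) auto
    then have "a / K\<^sup>2 \<le> b"
      using K(1) by (simp add: b_def field_simps power_mult_distrib)
    then have "\<eta> * a \<le> t\<^sup>2 * (\<epsilon>\<^sup>2 - t\<^sup>2) * b"
      using mult_left_mono[of "a / K\<^sup>2" b "t\<^sup>2 * (\<epsilon>\<^sup>2 - t\<^sup>2)"] t\<epsilon> by (simp add: \<eta>_def)
    with le show ?thesis
      by (simp add: a_def q_def algebra_simps)
  qed
  have "lower_bound_on UNIV A (sqrt (\<epsilon>\<^sup>2 + \<eta>))"
  proof (rule lower_bound_onI)
    fix y
    obtain x where "y = A x"
      using surj by blast
    then have "sqrt ((\<epsilon>\<^sup>2 + \<eta>) * (norm y)\<^sup>2) \<le> sqrt ((norm (A y))\<^sup>2)"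
      using key by (intro real_sqrt_le_mono) simp
    then show "sqrt (\<epsilon>\<^sup>2 + \<eta>) * norm y \<le> norm (A y)"
      by (simp add: real_sqrt_mult)
  qed
  moreover have "sqrt (\<epsilon>\<^sup>2 + \<eta>) > \<epsilon>"
    using \<eta> \<epsilon> by (simp add: real_less_rsqrt)
  ultimately show False
    using z by (auto simp: approx_pseudospectrum_on_def A_def)
qed

section \<open>Finite rank projections\<close>

lemma orthogonal_projectionD:
  assumes "orthogonal_projection P"
  shows "bounded_op_on UNIV P" "cinner (P v) w = cinner v (P w)" "P (P v) = P v"
  using assms by (auto simp: orthogonal_projection_def is_adjoint_on_def fun_eq_iff)

lemma orthogonal_projection_range:
  "orthogonal_projection P \<Longrightarrow> v \<in> range P \<longleftrightarrow> P v = v"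
  by (metis orthogonal_projectionD(3) rangeE rangeI)

lemma orthogonal_projection_norm_le:
  assumes "orthogonal_projection P"
  shows "norm (P v) \<le> norm v"
proof -
  have "complex_of_real ((norm (P v))\<^sup>2) = cinner v (P v)"
    using orthogonal_projectionD[OF assms] by (simp only: cinner_self[symmetric])
  from arg_cong[OF this, of Re] have "norm (P v) * norm (P v) \<le> norm v * norm (P v)"
    using Re_cinner_le[of v "P v"] by (simp add: power2_eq_square)
  then show ?thesis
    by (cases "P v = 0") auto
qed

lemma subspace_range_projection:
  assumes "orthogonal_projection P"
  shows "complex_vector.subspace (range P)"
proof -
  note P = bounded_op_onD[OF orthogonal_projectionD(1)[OF assms]]
  have "P 0 = 0"
    by (rule bounded_op_on_zero[OF complex_vector.subspace_UNIV orthogonal_projectionD(1)[OF assms]])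
  then show ?thesis
    unfolding complex_vector.subspace_def
    by (simp add: orthogonal_projection_range[OF assms] P(2,3))
qed

text \<open>A dimension count: the image of a basis of the range is independent and of the same
  size, so a vector outside its span would give an independent set that is too large.\<close>

lemma finite_rank_inj_imp_surj:
  fixes P X :: "'a::complex_inner \<Rightarrow> 'a"
  assumes P: "orthogonal_projection P" "finite_rank P"
    and X: "bounded_op_on (range P) X" and inj: "inj_on X (range P)"
  shows "range P \<subseteq> X ` range P"
proof
  fix w assume w: "w \<in> range P"
  note P' = bounded_op_onD[OF orthogonal_projectionD(1)[OF P(1)]]
  \<comment> \<open>\<open>X\<close> is linear only on \<open>range P\<close>; precomposing with
    \<open>P\<close> gives a map that is linear on the whole space and agrees with \<open>X\<close>
    on the range.\<close>
  define f where "f = X \<circ> P"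
  interpret f: Vector_Spaces.linear "scaleC :: complex \<Rightarrow> 'a \<Rightarrow> 'a" "scaleC :: complex \<Rightarrow> 'a \<Rightarrow> 'a" f
    unfolding f_def
    by unfold_locales (simp_all add: P'(2,3) bounded_op_onD(2,3)[OF X])
  have sub: "complex_vector.subspace (range P)"
    by (rule subspace_range_projection[OF P(1)])
  have fX: "f v = X v" if "v \<in> range P" for v
    using that orthogonal_projection_range[OF P(1)] by (simp add: f_def)
  obtain S where S: "finite S" "range P \<subseteq> cspan S"
    using P(2) by (auto simp: finite_rank_def)
  obtain B where B: "B \<subseteq> range P" "\<not> complex_vector.dependent B" "range P \<subseteq> cspan B"
    using complex_vector.maximal_independent_subset[of "range P"] by blast
  have span: "cspan B = range P"
    using B complex_vector.span_minimal[OF B(1) sub] by auto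
  have fin: "finite B"
    using complex_vector.independent_span_bound[OF S(1) B(2)] B(1) S(2) by auto
  have injf: "inj_on f (cspan B)"
    using inj fX unfolding span inj_on_def by simp
  have ind: "\<not> complex_vector.dependent (f ` B)"
    using f.independent_injective_image[OF B(2)] injf by (simp add: cspan_def)
  have "w \<in> cspan (f ` B)"
  proof (rule ccontr)
    assume nw: "w \<notin> cspan (f ` B)"
    then have "\<not> complex_vector.dependent (insert w (f ` B))"
      using ind by (rule complex_vector.independent_insertI)
    moreover have "f ` B \<subseteq> range P"
      using B(1) bounded_op_onD(1)[OF X] fX by (metis image_subsetI subsetD)
    then have "insert w (f ` B) \<subseteq> cspan B"
      using w by (simp add: span)
    ultimately have "card (insert w (f ` B)) \<le> card B"
      using complex_vector.independent_span_bound[OF fin] by blast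
    moreover have "card (f ` B) = card B"
      using injf complex_vector.span_superset by (intro card_image) (rule inj_on_subset)
    moreover have "w \<notin> f ` B"
      using nw complex_vector.span_base[of w "f ` B"] by metis
    ultimately show False
      using fin by simp
  qed
  then have "w \<in> f ` range P"
    using f.span_image[of B] span by (simp add: cspan_def)
  then show "w \<in> X ` range P"
    using fX by auto
qed

lemma finite_rank_bounded_below_invertible:
  assumes P: "orthogonal_projection P" "finite_rank P" and X: "bounded_op_on (range P) X"
  shows "bounded_below_invertible (range P) X"
  unfolding bounded_below_invertible_def
proof (intro allI impI)
  fix z c assume c: "(c::real) > 0" "lower_bound_on (range P) (\<lambda>v. z *\<^sub>C v - X v) c"
  have sub: "complex_vector.subspace (range P)"
    by (rule subspace_range_projection[OF P(1)])
  have zX: "bounded_op_on (range P) (\<lambda>v. z *\<^sub>C v - X v)"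
    by (rule bounded_op_on_shift[OF sub X])
  show "invertible_on (range P) (\<lambda>v. z *\<^sub>C v - X v)"
    by (intro invertible_onI[OF sub zX c] finite_rank_inj_imp_surj[OF P zX] lower_bound_on_inj[OF sub zX c])
qed

section \<open>Adjoints\<close>

text \<open>If \<open>f\<close> is the pairing with \<open>u\<close>, then \<open>J x\<close> below
  is |x - u|^2 - |u|^2, so the representing vector is found as the minimiser of
  \<open>J\<close>.\<close>

lemma Riesz_representation:
  fixes f :: "'a::chilbert_space \<Rightarrow> complex"
  assumes add: "\<And>x y. f (x + y) = f x + f y" and scale: "\<And>a x. f (a *\<^sub>C x) = a * f x"
    and bound: "\<And>x. cmod (f x) \<le> K * norm x"
  shows "\<exists>u. \<forall>x. f x = cinner u x"
proof -
  have scaleR: "f (r *\<^sub>R x) = r *\<^sub>R f x" for r x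
    by (simp only: scaleR_scaleC[of r x] scale scaleR_conv_of_real)
  have bl: "bounded_linear f"
    by (rule bounded_linear_intro[of _ K]) (simp_all add: add scaleR bound mult.commute)
  define J where "J x = (norm x)\<^sup>2 - 2 * Re (f x)" for x
  have "- K\<^sup>2 \<le> J x" for x
  proof -
    have "0 \<le> (norm x - K)\<^sup>2" by simp
    moreover have "Re (f x) \<le> K * norm x"
      using bound[of x] complex_Re_le_cmod[of "f x"] by linarith
    ultimately show ?thesis
      by (simp add: J_def power2_eq_square algebra_simps)
  qed
  then have bdd: "bdd_below (range J)"
    by (intro bdd_belowI2)
  define m where "m = Inf (range J)"
  have m: "m \<le> J x" for x
    using bdd by (auto simp: m_def intro: cInf_lower)
  have "\<exists>x. J x < m + inverse (real (Suc n))" for n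
  proof (rule ccontr)
    assume "\<not> ?thesis"
    then have "m + inverse (real (Suc n)) \<le> m"
      unfolding m_def by (intro cInf_greatest) (auto simp: not_less)
    then show False by simp
  qed
  then obtain x where x: "\<And>n. J (x n) < m + inverse (real (Suc n))"
    by metis
  \<comment> \<open>\<open>J\<close> is at least \<open>m\<close> at the midpoint of
    \<open>y\<close> and \<open>z\<close>, so the parallelogram law makes near-minimisers close to
    each other; minimising sequences are therefore Cauchy.\<close>
  have diff: "(norm (y - z))\<^sup>2 \<le> 2 * (J y - m) + 2 * (J z - m)" for y z
  proof -
    have "4 * J ((1/2) *\<^sub>R (y + z)) = (norm (y + z))\<^sup>2 - 4 * Re (f y) - 4 * Re (f z)"
      by (simp only: J_def scaleR add norm_scaleR power_mult_distrib) (simp add: power_divide algebra_simps add_divide_distrib)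
    then have "(norm (y - z))\<^sup>2 = 2 * J y + 2 * J z - 4 * J ((1/2) *\<^sub>R (y + z))"
      using parallelogram_law[of y z] by (simp add: J_def)
    then show ?thesis
      using m[of "(1/2) *\<^sub>R (y + z)"] by simp
  qed
  have "Cauchy x"
  proof (rule CauchyI)
    fix e :: real assume e: "e > 0"
    obtain N where N: "inverse (real (Suc N)) < e\<^sup>2 / 4"
      using reals_Archimedean[of "e\<^sup>2 / 4"] e by auto
    have "norm (x k - x n) < e" if "k \<ge> N" "n \<ge> N" for k n
    proof -
      have "J (x l) - m < e\<^sup>2 / 4" if "l \<ge> N" for l
      proof -
        have "inverse (real (Suc l)) \<le> inverse (real (Suc N))"
          using that by (intro le_imp_inverse_le) auto
        with x[of l] N show ?thesis by linarith
      qed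
      from this[OF that(1)] this[OF that(2)] have "(norm (x k - x n))\<^sup>2 < e\<^sup>2"
        using diff[of "x k" "x n"] by (simp add: field_simps)
      then show ?thesis
        using e by (simp add: power_less_imp_less_base)
    qed
    then show "\<exists>N. \<forall>k\<ge>N. \<forall>n\<ge>N. norm (x k - x n) < e" by blast
  qed
  then obtain u where u: "x \<longlonglongrightarrow> u"
    using Cauchy_convergent convergent_def by blast
  have "(\<lambda>n. J (x n)) \<longlonglongrightarrow> J u"
    unfolding J_def by (intro tendsto_intros bounded_linear.tendsto[OF bl] u)
  moreover have "(\<lambda>n. m + inverse (real (Suc n))) \<longlonglongrightarrow> m + 0"
    by (intro tendsto_intros LIMSEQ_inverse_real_of_nat)
  ultimately have "J u \<le> m"
    using x LIMSEQ_le[of "\<lambda>n. J (x n)" "J u" "\<lambda>n. m + inverse (real (Suc n))" "m + 0"]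
    by (auto intro: less_imp_le)
  then have min: "J u \<le> J y" for y
    using m[of y] by linarith
  have Re_eq: "Re (f y) = Re (cinner u y)" for y
  proof -
    define a b where "a = Re (cinner u y) - Re (f y)" and "b = (norm y)\<^sup>2"
    have b: "b \<ge> 0" by (simp add: b_def)
    have quad: "0 \<le> 2 * t * a + t\<^sup>2 * b" for t
    proof -
      have "Re (cinner u (t *\<^sub>R y)) = t * Re (cinner u y)"
        by (simp add: scaleR_scaleC cinner_simps)
      then have "J (u + t *\<^sub>R y) - J u = 2 * t * a + t\<^sup>2 * b"
        by (simp add: J_def norm_add_sq add scaleR a_def b_def power_mult_distrib algebra_simps)
      then show ?thesis
        using min[of "u + t *\<^sub>R y"] by linarith
    qed
    \<comment> \<open>The optimal parameter in \<open>quad\<close> would be \<open>- a / b\<close>;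
      the denominator \<open>b + 1\<close> avoids the case \<open>b = 0\<close> and still forces
      \<open>a = 0\<close>.\<close>
    define s where "s = 1 / (b + 1)"
    have s: "s > 0" "s * b \<le> 1"
      using b by (auto simp: s_def field_simps)
    have "2 * (a\<^sup>2 * s) \<le> (a\<^sup>2 * s) * (s * b)"
      using quad[of "- (a * s)"] by (simp add: power2_eq_square mult_ac)
    also have "\<dots> \<le> (a\<^sup>2 * s) * 1"
      using s by (intro mult_left_mono) auto
    finally have "a = 0"
      using s(1) by (simp add: mult_le_0_iff)
    then show ?thesis
      by (simp add: a_def)
  qed
  \<comment> \<open>Real parts suffice: replacing \<open>y\<close> by
    \<open>\<i> *\<^sub>C y\<close> turns imaginary parts into real ones.\<close>
  have "f y = cinner u y" for y
    using Re_eq[of y] Re_eq[of "\<i> *\<^sub>C y"] by (simp add: scale cinner_simps complex_eq_iff)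
  then show ?thesis by blast
qed

lemma is_adjoint_on_adjoint_on:
  "is_adjoint_on M X Y \<Longrightarrow> is_adjoint_on M X (adjoint_on M X)"
  unfolding adjoint_on_def by (rule someI[where P = "is_adjoint_on M X"])

text \<open>The square of the norm of \<open>F w\<close> is the pairing of \<open>E (F w)\<close>
  with \<open>w\<close>. The estimate serves to show that the adjoint being constructed is bounded
  and, later, to bound the adjoint of a commutator.\<close>

lemma adjoint_norm_le:
  fixes E F :: "'a::complex_inner \<Rightarrow> 'a"
  assumes adj: "\<And>v w. cinner (E v) w = cinner v (F w)" and K: "\<And>v. norm (E v) \<le> K * norm v"
  shows "norm (F w) \<le> K * norm w"
proof (cases "F w = 0")
  case True
  then show ?thesis
    using K[of w] order_trans[OF norm_ge_zero] by auto
next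
  case False
  have "norm (F w) * norm (F w) = Re (cinner (E (F w)) w)"
    by (simp add: adj cinner_self power2_eq_square)
  also have "\<dots> \<le> norm (E (F w)) * norm w"
    by (rule Re_cinner_le)
  also have "\<dots> \<le> K * norm (F w) * norm w"
    by (intro mult_right_mono K) simp
  also have "\<dots> = (K * norm w) * norm (F w)"
    by simp
  finally show ?thesis
    using False by simp
qed

lemma ex_adjoint:
  fixes T :: "'a::chilbert_space \<Rightarrow> 'a"
  assumes T: "bounded_op_on UNIV T"
  shows "\<exists>Y. is_adjoint_on UNIV T Y"
proof -
  note T' = bounded_op_onD[OF T]
  obtain K where K: "K > 0" "\<And>v. norm (T v) \<le> K * norm v"
    using bounded_op_on_UNIV_bound[OF T] by metis
  have "\<exists>u. \<forall>v. cinner w (T v) = cinner u v" for w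
  proof (rule Riesz_representation[where K = "norm w * K"])
    show "cmod (cinner w (T v)) \<le> norm w * K * norm v" for v
      using cmod_cinner_le[of w "T v"] mult_left_mono[OF K(2), of "norm w" v] by (simp add: mult.assoc)
  qed (simp_all add: T' cinner_simps)
  then obtain Y where Y: "\<And>w v. cinner w (T v) = cinner (Y w) v"
    by metis
  have adj: "cinner (T v) w = cinner v (Y w)" for v w
    using Y[of w v] by (metis cinner_commute)
  have eqI: "a = b" if "\<And>v. cinner v a = cinner v b" for a b :: 'a
    using that[of "a - b"] cinner_eq_zero_iff[of "a - b"] by (simp add: cinner_diff_right)
  have "Y (a + b) = Y a + Y b" for a b
    by (rule eqI) (simp add: cinner_add_right flip: adj)
  moreover have "Y (c *\<^sub>C a) = c *\<^sub>C Y a" for c a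
    by (rule eqI) (simp add: cinner_scaleC_right flip: adj)
  moreover have "norm (Y w) \<le> K * norm w" for w
    using adj K(2) by (rule adjoint_norm_le)
  ultimately show ?thesis
    unfolding is_adjoint_on_def bounded_op_on_def using adj by blast
qed

section \<open>Hausdorff convergence\<close>

lemma hausdorff_dist_lessD:
  assumes "hausdorff_dist S L < ennreal e" and "e > 0"
  shows "x \<in> S \<Longrightarrow> \<exists>y\<in>L. dist x y < e" and "y \<in> L \<Longrightarrow> \<exists>x\<in>S. dist y x < e"
proof -
  have *: "\<exists>y\<in>B. dist x y < e"
    if lt: "(SUP x\<in>A. INF y\<in>B. ennreal (dist x y)) < ennreal e" and x: "x \<in> A" for A B :: "'a set" and x
  proof -
    have "(INF y\<in>B. ennreal (dist x y)) < ennreal e"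
      using lt x by (meson SUP_upper le_less_trans)
    then show ?thesis
      by (simp add: INF_less_iff ennreal_less_iff)
  qed
  show "x \<in> S \<Longrightarrow> \<exists>y\<in>L. dist x y < e" "y \<in> L \<Longrightarrow> \<exists>x\<in>S. dist y x < e"
    using assms(1) by (auto simp: hausdorff_dist_def intro: *)
qed

lemma hausdorff_dist_leI:
  assumes "\<And>x. x \<in> S \<Longrightarrow> \<exists>y\<in>L. dist x y \<le> e" and "\<And>y. y \<in> L \<Longrightarrow> \<exists>x\<in>S. dist y x \<le> e"
  shows "hausdorff_dist S L \<le> ennreal e"
proof -
  have *: "(SUP x\<in>A. INF y\<in>B. ennreal (dist x y)) \<le> ennreal e"
    if "\<And>x. x \<in> A \<Longrightarrow> \<exists>y\<in>B. dist x y \<le> e" for A B :: "'a set"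
    using that by (intro SUP_least) (meson INF_lower2 ennreal_leI)
  show ?thesis
    unfolding hausdorff_dist_def using assms by (simp add: *)
qed

text \<open>By symmetry this gives uniqueness of limits, hence that the \<open>THE\<close> in
  \<open>hausdorff_lim\<close> is well defined. A point of \<open>L\<close> is compared with
  \<open>L'\<close> through a late \<open>S n\<close>, and \<open>L'\<close> is closed.\<close>

lemma hausdorff_tendsto_subset:
  assumes "hausdorff_tendsto S L" "hausdorff_tendsto S L'"
  shows "L \<subseteq> L'"
proof
  fix x assume x: "x \<in> L"
  have "\<exists>z\<in>L'. dist z x < e" if "e > 0" for e
  proof -
    have "\<forall>\<^sub>F n in sequentially. hausdorff_dist (S n) L < ennreal (e / 2)"
      "\<forall>\<^sub>F n in sequentially. hausdorff_dist (S n) L' < ennreal (e / 2)"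
      using assms \<open>e > 0\<close> unfolding hausdorff_tendsto_def by (auto intro: order_tendstoD)
    then have "\<forall>\<^sub>F n in sequentially. hausdorff_dist (S n) L < ennreal (e / 2)
        \<and> hausdorff_dist (S n) L' < ennreal (e / 2)"
      by (rule eventually_conj)
    then obtain n where n: "hausdorff_dist (S n) L < ennreal (e / 2)"
      "hausdorff_dist (S n) L' < ennreal (e / 2)"
      by (auto dest: eventually_happens)
    obtain y where y: "y \<in> S n" "dist x y < e / 2"
      using hausdorff_dist_lessD(2)[OF n(1) _ x] \<open>e > 0\<close> by auto
    obtain z where "z \<in> L'" "dist y z < e / 2"
      using hausdorff_dist_lessD(1)[OF n(2) _ y(1)] \<open>e > 0\<close> by auto
    then show ?thesis
      using y(2) dist_triangle_half_r[of y x e z] by (auto simp: dist_commute intro!: bexI[of _ z])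
  qed
  then have "x \<in> closure L'"
    by (simp add: closure_approachable)
  then show "x \<in> L'"
    using assms(2) by (simp add: hausdorff_tendsto_def compact_imp_closed)
qed

lemma hausdorff_lim_eq: "hausdorff_tendsto S L \<Longrightarrow> hausdorff_lim S = L"
  unfolding hausdorff_lim_def by (rule the_equality) (auto dest: hausdorff_tendsto_subset)

text \<open>\<open>avoid\<close> and \<open>hit\<close> are conditions at single points, with no
  uniformity. Finite subcovers, of the part of \<open>K\<close> away from \<open>L\<close> and of
  \<open>L\<close> itself, make them uniform. Empty sets are permitted throughout.\<close>

lemma hausdorff_tendstoI:
  fixes S :: "nat \<Rightarrow> 'a::metric_space set"
  assumes S: "\<And>n. compact (S n)" and L: "compact L" and K: "compact K"
    and SK: "\<forall>\<^sub>F n in sequentially. S n \<subseteq> K"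
    and avoid: "\<And>z. z \<notin> L \<Longrightarrow> \<exists>r>0. \<forall>\<^sub>F n in sequentially. S n \<inter> ball z r = {}"
    and hit: "\<And>z r. z \<in> L \<Longrightarrow> r > 0 \<Longrightarrow> \<forall>\<^sub>F n in sequentially. S n \<inter> ball z r \<noteq> {}"
  shows "hausdorff_tendsto S L"
proof -
  have near_L: "\<forall>\<^sub>F n in sequentially. \<forall>x\<in>S n. \<exists>y\<in>L. dist x y \<le> e" if e: "e > 0" for e
  proof -
    define C where "C = K - (\<Union>y\<in>L. ball y e)"
    have "compact C"
      unfolding C_def using K by (intro compact_diff) auto
    obtain r where r: "\<And>z. z \<notin> L \<Longrightarrow> r z > 0"
      "\<And>z. z \<notin> L \<Longrightarrow> \<forall>\<^sub>F n in sequentially. S n \<inter> ball z (r z) = {}"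
      using avoid by metis
    have CL: "z \<notin> L" if "z \<in> C" for z
      using that e by (auto simp: C_def)
    then have "C \<subseteq> (\<Union>z\<in>C. ball z (r z))"
      using r(1) by fastforce
    then obtain F where F: "F \<subseteq> C" "finite F" "C \<subseteq> (\<Union>z\<in>F. ball z (r z))"
      using compactE_image[OF \<open>compact C\<close>, of C "\<lambda>z. ball z (r z)"] by auto
    have "\<forall>\<^sub>F n in sequentially. \<forall>z\<in>F. S n \<inter> ball z (r z) = {}"
      using F r(2) CL by (intro eventually_ball_finite) auto
    with SK show ?thesis
    proof eventually_elim
      case (elim n)
      show ?case
      proof
        fix x assume "x \<in> S n"
        then have "x \<notin> C" "x \<in> K"
          using elim F(3) by blast+
        then show "\<exists>y\<in>L. dist x y \<le> e"
          by (auto simp: C_def dist_commute intro: less_imp_le)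
      qed
    qed
  qed
  have near_S: "\<forall>\<^sub>F n in sequentially. \<forall>y\<in>L. \<exists>x\<in>S n. dist y x \<le> e" if e: "e > 0" for e
  proof -
    have "L \<subseteq> (\<Union>z\<in>L. ball z (e / 2))"
      using e by auto
    then obtain F where F: "F \<subseteq> L" "finite F" "L \<subseteq> (\<Union>z\<in>F. ball z (e / 2))"
      using compactE_image[OF L, of L "\<lambda>z. ball z (e / 2)"] by auto
    have "\<forall>\<^sub>F n in sequentially. \<forall>z\<in>F. S n \<inter> ball z (e / 2) \<noteq> {}"
      using F hit e by (intro eventually_ball_finite) auto
    then show ?thesis
    proof eventually_elim
      case (elim n)
      show ?case
      proof
        fix y assume "y \<in> L"
        then obtain z where z: "z \<in> F" "dist z y < e / 2"
          using F(3) by auto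
        then obtain x where "x \<in> S n" "dist z x < e / 2"
          using elim by fastforce
        with z show "\<exists>x\<in>S n. dist y x \<le> e"
          using dist_triangle_half_r[of z y e x] by (auto intro: less_imp_le)
      qed
    qed
  qed
  have "(\<lambda>n. hausdorff_dist (S n) L) \<longlonglongrightarrow> 0"
  proof (rule order_tendstoI)
    fix a :: ennreal assume "0 < a"
    \<comment> \<open>\<open>a\<close> may be infinite, while the estimates need a real radius; a
      value strictly between 0 and \<open>a\<close> is finite and positive.\<close>
    then obtain b where b: "0 < b" "b < a"
      using dense by blast
    then have "b = ennreal (enn2real b)"
      by (metis ennreal_enn2real top.extremum_strict less_trans top.not_eq_extremum)
    then obtain e where e: "e > 0" "ennreal e < a"
      using b by (metis ennreal_less_zero_iff)
    from near_L[OF e(1)] near_S[OF e(1)] show "\<forall>\<^sub>F n in sequentially. hausdorff_dist (S n) L < a"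
    proof eventually_elim
      case (elim n)
      then have "hausdorff_dist (S n) L \<le> ennreal e"
        by (intro hausdorff_dist_leI) auto
      with e(2) show ?case by (rule le_less_trans[rotated])
    qed
  qed simp
  with S L show ?thesis
    by (simp add: hausdorff_tendsto_def)
qed

section \<open>Positive symmetric operators\<close>

text \<open>Expand \<open>0 \<le> \<langle>D w, w\<rangle>\<close> for \<open>w = v - D v / K\<close>.\<close>

lemma positive_norm_sq_le:
  assumes M: "complex_vector.subspace M" and D: "bounded_op_on M D"
    and sym: "\<And>v w. v \<in> M \<Longrightarrow> w \<in> M \<Longrightarrow> cinner (D v) w = cinner v (D w)"
    and pos: "\<And>v. v \<in> M \<Longrightarrow> 0 \<le> Re (cinner (D v) v)"
    and K: "K > 0" "\<And>v. v \<in> M \<Longrightarrow> norm (D v) \<le> K * norm v" and v: "v \<in> M"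
  shows "(norm (D v))\<^sup>2 \<le> K * Re (cinner (D v) v)"
proof -
  define a b where "a = Re (cinner (D v) v)" and "b = (norm (D v))\<^sup>2"
  define t where "t = complex_of_real (1 / K)"
  have Dv: "D v \<in> M" "D (D v) \<in> M"
    using bounded_op_onD(1)[OF D] v by auto
  have tDv: "t *\<^sub>C D v \<in> M"
    using Dv M by (simp add: complex_vector.subspace_scale)
  have "D (v - t *\<^sub>C D v) = D v - t *\<^sub>C D (D v)"
    using bounded_op_on_diff[OF M D v tDv] bounded_op_onD(3)[OF D Dv(1)] by simp
  moreover have "cinner (D (D v)) v = cinner (D v) (D v)"
    using sym[OF Dv(1) v] .
  moreover have "v - t *\<^sub>C D v \<in> M"
    using v tDv M by (simp add: complex_vector.subspace_diff)
  ultimately have "0 \<le> Re (cinner (D v) v - t * cinner (D v) (D v)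
      - cnj t * (cinner (D v) (D v) - t * cinner (D (D v)) (D v)))"
    using pos[of "v - t *\<^sub>C D v"] by (simp add: cinner_simps t_def right_diff_distrib)
  also have "\<dots> = a - 2 * (b / K) + Re (cinner (D (D v)) (D v)) / K\<^sup>2"
    by (simp add: t_def a_def b_def cinner_self power2_eq_square diff_divide_distrib)
  finally have "0 \<le> a - 2 * (b / K) + Re (cinner (D (D v)) (D v)) / K\<^sup>2" .
  moreover have "Re (cinner (D (D v)) (D v)) / K\<^sup>2 \<le> b / K"
  proof -
    have "Re (cinner (D (D v)) (D v)) \<le> norm (D (D v)) * norm (D v)"
      by (rule Re_cinner_le)
    also have "\<dots> \<le> K * norm (D v) * norm (D v)"
      using K(2)[OF Dv(1)] by (intro mult_right_mono) auto
    finally show ?thesis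
      using K(1) by (simp add: b_def field_simps power2_eq_square)
  qed
  ultimately have "b / K \<le> a"
    by linarith
  then show ?thesis
    using K(1) by (simp add: a_def b_def field_simps)
qed

text \<open>This replaces the spectral theorem. Let \<open>m\<close> be the best lower bound of
  \<open>C = \<mu> - B\<close>; it is below \<open>\<delta>\<close>. If neither
  \<open>\<mu> - m\<close> nor \<open>\<mu> + m\<close> were an approximate eigenvalue, the positive
  operator \<open>C\<^sup>2 - m\<^sup>2\<close> would be bounded below as the product of
  \<open>C - m\<close> and \<open>C + m\<close>, and \<open>positive_norm_sq_le\<close> would then
  improve the lower bound of \<open>C\<close> beyond \<open>m\<close>.\<close>

lemma approx_eigenvalue_near:
  assumes M: "complex_vector.subspace M" and B: "bounded_op_on M B"
    and sym: "\<And>v w. v \<in> M \<Longrightarrow> w \<in> M \<Longrightarrow> cinner (B v) w = cinner v (B w)"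
    and v: "v \<in> M" "norm (complex_of_real \<mu> *\<^sub>C v - B v) < \<delta> * norm v"
  shows "\<exists>k. \<bar>k - \<mu>\<bar> < \<delta> \<and> complex_of_real k \<in> approx_pseudospectrum_on 0 M B"
proof -
  define C where "C = (\<lambda>w. complex_of_real \<mu> *\<^sub>C w - B w)"
  have C: "bounded_op_on M C"
    unfolding C_def by (rule bounded_op_on_shift[OF M B])
  note C' = bounded_op_onD[OF C]
  have symC: "cinner (C w) x = cinner w (C x)" if "w \<in> M" "x \<in> M" for w x
    using sym[OF that] by (simp add: C_def cinner_simps)
  define m where "m = (INF w\<in>M - {0}. norm (C w) / norm w)"
  have v0: "v \<noteq> 0"
    using v(2) bounded_op_on_zero[OF M B] by auto
  have bdd: "bdd_below ((\<lambda>w. norm (C w) / norm w) ` (M - {0}))"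
    by (intro bdd_belowI2[of _ 0]) simp
  have m_le: "m * norm w \<le> norm (C w)" if "w \<in> M" for w
  proof (cases "w = 0")
    case False
    then have "m \<le> norm (C w) / norm w"
      unfolding m_def using bdd that by (intro cINF_lower) auto
    with False show ?thesis by (simp add: field_simps)
  qed simp
  have m0: "m \<ge> 0"
    unfolding m_def using v v0 by (intro cINF_greatest) auto
  have "m * norm v < \<delta> * norm v"
    using m_le[OF v(1)] v(2) by (simp add: C_def)
  then have m\<delta>: "m < \<delta>"
    by (simp add: mult_less_cancel_right)
  have "complex_of_real (\<mu> - m) \<in> approx_pseudospectrum_on 0 M B
      \<or> complex_of_real (\<mu> + m) \<in> approx_pseudospectrum_on 0 M B"
  proof (rule ccontr)
    assume neg: "\<not> ?thesis"
    obtain c1 where c1: "c1 > 0" "lower_bound_on M (\<lambda>w. complex_of_real (\<mu> - m) *\<^sub>C w - B w) c1"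
      using neg by (auto simp: approx_pseudospectrum_on_def)
    obtain c2 where c2: "c2 > 0" "lower_bound_on M (\<lambda>w. complex_of_real (\<mu> + m) *\<^sub>C w - B w) c2"
      using neg by (auto simp: approx_pseudospectrum_on_def)
    define D where "D = (\<lambda>w. C (C w) - complex_of_real (m\<^sup>2) *\<^sub>C w)"
    \<comment> \<open>\<open>D\<close> is written as a shift of \<open>- (C \<circ> C)\<close>,
      itself a shift by 0, so that its boundedness comes from the rules for shifts and
      compositions.\<close>
    have "bounded_op_on M (\<lambda>w. complex_of_real (- (m\<^sup>2)) *\<^sub>C w - (\<lambda>w. - C (C w)) w)"
    proof (rule bounded_op_on_shift[OF M])
      have "bounded_op_on M (\<lambda>w. 0 *\<^sub>C w - (C \<circ> C) w)"
        by (rule bounded_op_on_shift[OF M bounded_op_on_comp[OF C C]])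
      then show "bounded_op_on M (\<lambda>w. - C (C w))" by simp
    qed
    then have D: "bounded_op_on M D"
      by (simp add: D_def)
    obtain K where K: "K > 0" "\<And>w. w \<in> M \<Longrightarrow> norm (D w) \<le> K * norm w"
      using bounded_op_on_bound[OF D] by blast
    have DC: "Re (cinner (D w) w) = (norm (C w))\<^sup>2 - m\<^sup>2 * (norm w)\<^sup>2" if "w \<in> M" for w
    proof -
      have "cinner (C (C w)) w = cinner (C w) (C w)"
        using symC[OF C'(1)[OF that] that] .
      then show ?thesis
        by (simp add: D_def cinner_simps cinner_self)
    qed
    have symD: "cinner (D w) x = cinner w (D x)" if "w \<in> M" "x \<in> M" for w x
      using that symC C'(1) by (simp add: D_def cinner_simps)
    have posD: "0 \<le> Re (cinner (D w) w)" if "w \<in> M" for w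
    proof -
      have "(m * norm w)\<^sup>2 \<le> (norm (C w))\<^sup>2"
        using m_le[OF that] m0 by (intro power_mono) auto
      then show ?thesis
        by (simp add: DC[OF that] power_mult_distrib)
    qed
    \<comment> \<open>\<open>c1 * c2\<close> is a lower bound of \<open>D\<close>, and
      \<open>K\<close> is the loss in passing from the norm of \<open>D w\<close> to the quadratic
      form of \<open>D\<close>.\<close>
    define \<eta> where "\<eta> = (c1 * c2)\<^sup>2 / K"
    have \<eta>: "\<eta> > 0"
      using c1 c2 K by (simp add: \<eta>_def)
    have key: "(m\<^sup>2 + \<eta>) * (norm w)\<^sup>2 \<le> (norm (C w))\<^sup>2" if w: "w \<in> M" for w
    proof -
      define y where "y = complex_of_real (\<mu> + m) *\<^sub>C w - B w"
      have y: "y = C w + complex_of_real m *\<^sub>C w"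
        by (simp add: y_def C_def scaleC_add_left)
      have mw: "complex_of_real m *\<^sub>C w \<in> M"
        using w M by (simp add: complex_vector.subspace_scale)
      have yM: "y \<in> M"
        using y mw C'(1)[OF w] M by (simp add: complex_vector.subspace_add)
      have "complex_of_real (\<mu> - m) *\<^sub>C y - B y = C y - complex_of_real m *\<^sub>C y"
        by (simp add: C_def complex_vector.scale_left_diff_distrib)
      also have "\<dots> = D w"
        using C'(2)[OF C'(1)[OF w] mw] C'(3)[OF w]
        by (simp add: y D_def scaleC_add_right scaleC_scaleC power2_eq_square)
      finally have "c1 * norm y \<le> norm (D w)"
        using lower_bound_onD[OF c1(2) yM] by simp
      moreover have "c2 * norm w \<le> norm y"
        using lower_bound_onD[OF c2(2) w] by (simp add: y_def)
      then have "c1 * (c2 * norm w) \<le> c1 * norm y"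
        using c1(1) by (intro mult_left_mono) auto
      ultimately have "c1 * c2 * norm w \<le> norm (D w)"
        by (metis mult.assoc order_trans)
      then have "(c1 * c2 * norm w)\<^sup>2 \<le> (norm (D w))\<^sup>2"
        using c1(1) c2(1) by (intro power_mono) auto
      also have "\<dots> \<le> K * ((norm (C w))\<^sup>2 - m\<^sup>2 * (norm w)\<^sup>2)"
        using positive_norm_sq_le[OF M D symD posD K w] DC[OF w] by simp
      finally show ?thesis
        using K(1) by (simp add: \<eta>_def field_simps power_mult_distrib)
    qed
    have "sqrt (m\<^sup>2 + \<eta>) \<le> norm (C w) / norm w" if "w \<in> M - {0}" for w
    proof -
      have "sqrt ((m\<^sup>2 + \<eta>) * (norm w)\<^sup>2) \<le> sqrt ((norm (C w))\<^sup>2)"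
        using that key by (intro real_sqrt_le_mono) auto
      then have "sqrt (m\<^sup>2 + \<eta>) * norm w \<le> norm (C w)"
        by (simp add: real_sqrt_mult)
      then show ?thesis
        using that by (simp add: pos_le_divide_eq)
    qed
    then have "sqrt (m\<^sup>2 + \<eta>) \<le> m"
      using v v0 by (subst (2) m_def) (intro cINF_greatest, auto)
    moreover have "m < sqrt (m\<^sup>2 + \<eta>)"
      using \<eta> by (intro real_less_rsqrt) simp
    ultimately show False by simp
  qed
  then show ?thesis
    using m0 m\<delta> by (auto intro: exI[of _ "\<mu> - m"] exI[of _ "\<mu> + m"])
qed

text \<open>For negative \<open>k\<close>, pairing \<open>(B - k) v\<close> with \<open>v\<close>
  gives at least \<open>- k * (norm v)\<^sup>2\<close>, so \<open>- k\<close> is a positive lower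
  bound.\<close>

lemma positive_approx_eigenvalue_nonneg:
  assumes pos: "\<And>v. v \<in> M \<Longrightarrow> 0 \<le> Re (cinner (B v) v)"
    and k: "complex_of_real k \<in> approx_pseudospectrum_on 0 M B"
  shows "k \<ge> 0"
proof (rule ccontr)
  assume neg: "\<not> k \<ge> 0"
  have "lower_bound_on M (\<lambda>v. complex_of_real k *\<^sub>C v - B v) (- k)"
  proof (rule lower_bound_onI)
    fix v assume v: "v \<in> M"
    define y where "y = complex_of_real k *\<^sub>C v - B v"
    have "- k * (norm v)\<^sup>2 \<le> Re (cinner (- y) v)"
      using pos[OF v] by (simp add: y_def cinner_simps cinner_self)
    also have "\<dots> \<le> norm y * norm v"
      using Re_cinner_le[of "- y" v] by simp
    finally have "(- k * norm v) * norm v \<le> norm y * norm v"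
      by (simp add: power2_eq_square mult.assoc)
    then show "- k * norm v \<le> norm y"
      by (cases "v = 0") (simp_all only: mult_le_cancel_right norm_ge_zero, auto)
  qed
  with k neg show False
    by (force simp: approx_pseudospectrum_on_def)
qed

section \<open>Square roots of spectra, as needed for singular values\<close>

definition nonneg_sqrt_set :: "complex set \<Rightarrow> complex set" where
  "nonneg_sqrt_set C = {complex_of_real s | s. 0 \<le> s \<and> complex_of_real (s\<^sup>2) \<in> C}"

lemma nonneg_sqrt_set_iff:
  "z \<in> nonneg_sqrt_set C \<longleftrightarrow> 0 \<le> Re z \<and> Im z = 0 \<and> z\<^sup>2 \<in> C"
proof
  assume "0 \<le> Re z \<and> Im z = 0 \<and> z\<^sup>2 \<in> C"
  moreover from this have "z = complex_of_real (Re z)"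
    by (simp add: complex_eq_iff)
  ultimately show "z \<in> nonneg_sqrt_set C"
    unfolding nonneg_sqrt_set_def by (metis (mono_tags, lifting) mem_Collect_eq of_real_power)
qed (auto simp: nonneg_sqrt_set_def simp flip: of_real_power)

lemma compact_nonneg_sqrt_set:
  assumes "compact C"
  shows "compact (nonneg_sqrt_set C)"
proof -
  obtain R where R: "\<And>z. z \<in> C \<Longrightarrow> cmod z \<le> R"
    using compact_imp_bounded[OF assms] by (auto simp: bounded_iff)
  have "closed {z. 0 \<le> Re z}" "closed {z. Im z = 0}" "closed ((\<lambda>z. z\<^sup>2) -` C)"
    using compact_imp_closed[OF assms]
    by (auto intro!: closed_Collect_le closed_Collect_eq continuous_intros closed_vimage)
  then have "closed ({z. 0 \<le> Re z} \<inter> {z. Im z = 0} \<inter> (\<lambda>z. z\<^sup>2) -` C)"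
    by (intro closed_Int)
  moreover have "nonneg_sqrt_set C = {z. 0 \<le> Re z} \<inter> {z. Im z = 0} \<inter> (\<lambda>z. z\<^sup>2) -` C"
    by (auto simp: nonneg_sqrt_set_iff)
  moreover have "cmod z \<le> sqrt R" if "z \<in> nonneg_sqrt_set C" for z
    using R[of "z\<^sup>2"] that by (simp add: nonneg_sqrt_set_iff norm_power real_le_rsqrt)
  then have "bounded (nonneg_sqrt_set C)"
    by (auto simp: bounded_iff)
  ultimately show ?thesis
    by (simp add: compact_eq_bounded_closed)
qed

section \<open>Asymptotically invariant sequences of subspaces\<close>

text \<open>Used twice: with \<open>T\<close> and its compressions, and with T* T and the operators
  A* A formed from the compressions A. The latter are not compressions of T* T, so \<open>Xn\<close>
  is tied to \<open>X\<close> only by the error \<open>\<delta>\<close>.\<close>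

locale asymptotic_compression =
  fixes P :: "nat \<Rightarrow> 'a::chilbert_space \<Rightarrow> 'a" and X :: "'a \<Rightarrow> 'a" and Xn :: "nat \<Rightarrow> 'a \<Rightarrow> 'a"
    and \<delta> :: "nat \<Rightarrow> real"
  assumes proj: "orthogonal_projection (P n)" and rank: "finite_rank (P n)"
    and P_lim: "(\<lambda>n. P n v) \<longlonglongrightarrow> v"
    and X: "bounded_op_on UNIV X" and Xn: "bounded_op_on (range (P n)) (Xn n)"
    and \<delta>_lim: "\<delta> \<longlonglongrightarrow> 0"
    and X_Xn: "v \<in> range (P n) \<Longrightarrow> norm (X v - Xn n v) \<le> \<delta> n * norm v"
begin

lemma subspace_range: "complex_vector.subspace (range (P n))"
  by (rule subspace_range_projection[OF proj])

lemma bounded_below_invertible_compression: "bounded_below_invertible (range (P n)) (Xn n)"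
  by (rule finite_rank_bounded_below_invertible[OF proj rank Xn])

text \<open>Solving \<open>(z - X\<^sub>n) v = P\<^sub>n w\<close> in the range of \<open>P\<^sub>n\<close> gives approximate solutions of \<open>(z - X) v = w\<close>, which
  converge because of the lower bound.\<close>

lemma bounded_below_invertible_limit: "bounded_below_invertible UNIV X"
  unfolding bounded_below_invertible_def
proof (intro allI impI)
  fix z c assume c: "(c::real) > 0" "lower_bound_on UNIV (\<lambda>v. z *\<^sub>C v - X v) c"
  define A where "A = (\<lambda>v. z *\<^sub>C v - X v)"
  have A: "bounded_op_on UNIV A"
    unfolding A_def by (rule bounded_op_on_shift[OF complex_vector.subspace_UNIV X])
  have "w \<in> range A" for w
  proof -
    \<comment> \<open>The norm bound is part of the condition because the error of the approximate
      solution is \<open>\<delta> n\<close> times its norm, and must tend to 0.\<close>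
    define good where "good n v \<longleftrightarrow> v \<in> range (P n) \<and> norm v \<le> norm w / (c / 2) \<and> z *\<^sub>C v - Xn n v = P n w" for n v
    have ev: "\<forall>\<^sub>F n in sequentially. \<exists>v. good n v"
      using order_tendstoD(2)[OF \<delta>_lim half_gt_zero[OF c(1)]]
    proof eventually_elim
      case (elim n)
      have "lower_bound_on (range (P n)) (\<lambda>v. z *\<^sub>C v - Xn n v) (c - dist z z - \<delta> n)"
        using c(2) subset_UNIV X_Xn by (rule lower_bound_on_perturb)
      then have lb: "lower_bound_on (range (P n)) (\<lambda>v. z *\<^sub>C v - Xn n v) (c / 2)"
        using elim unfolding lower_bound_on_def
        by (smt (verit) dist_self field_sum_of_halves mult_right_mono norm_ge_zero)
      then obtain Y where Y: "is_inverse_on (range (P n)) (\<lambda>v. z *\<^sub>C v - Xn n v) Y"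
        using bounded_below_invertible_compression[of n] half_gt_zero[OF c(1)]
        unfolding bounded_below_invertible_def invertible_on_def by blast
      have "norm (Y (P n w)) \<le> norm (P n w) / (c / 2)"
        using c(1) by (intro is_inverse_on_norm_le[OF Y lb]) auto
      also have "\<dots> \<le> norm w / (c / 2)"
        using c(1) orthogonal_projection_norm_le[OF proj] by (intro divide_right_mono) auto
      finally have "good n (Y (P n w))"
        using Y by (auto simp: good_def is_inverse_on_def bounded_op_on_def)
      then show ?case by blast
    qed
    \<comment> \<open>For small \<open>n\<close> there may be no solution and \<open>v n\<close> is
      arbitrary; only late terms are used.\<close>
    define v where "v n = (SOME v. good n v)" for n
    have good: "\<forall>\<^sub>F n in sequentially. good n (v n)"
      using ev by eventually_elim (auto simp: v_def intro: someI_ex)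
    have bnd: "\<forall>\<^sub>F n in sequentially. norm (A (v n) - P n w) \<le> \<bar>\<delta> n\<bar> * (norm w / (c / 2))"
      using good
    proof eventually_elim
      case (elim n)
      then have "P n w = z *\<^sub>C v n - Xn n (v n)"
        by (simp add: good_def)
      then have "norm (A (v n) - P n w) = norm (X (v n) - Xn n (v n))"
        by (simp add: A_def norm_minus_commute)
      also have "\<dots> \<le> \<bar>\<delta> n\<bar> * norm (v n)"
        using elim X_Xn[of "v n" n] by (smt (verit) good_def mult_right_mono norm_ge_zero)
      also have "\<dots> \<le> \<bar>\<delta> n\<bar> * (norm w / (c / 2))"
        using elim by (intro mult_left_mono) (auto simp: good_def)
      finally show ?case .
    qed
    have "(\<lambda>n. A (v n) - P n w) \<longlonglongrightarrow> 0"
      using bnd tendsto_mult_left_zero[OF tendsto_rabs_zero[OF \<delta>_lim]] by (rule Lim_null_comparison)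
    from tendsto_add[OF this P_lim[of w]] have Av: "(\<lambda>n. A (v n)) \<longlonglongrightarrow> w"
      by simp
    have "Cauchy v"
    proof (rule CauchyI)
      fix e :: real assume "e > 0"
      then obtain N where N: "\<And>k n. k \<ge> N \<Longrightarrow> n \<ge> N \<Longrightarrow> norm (A (v k) - A (v n)) < c * e"
        using CauchyD[OF LIMSEQ_imp_Cauchy[OF Av], of "c * e"] c(1) by auto
      have "norm (v k - v n) < e" if "k \<ge> N" "n \<ge> N" for k n
      proof -
        have "c * norm (v k - v n) \<le> norm (A (v k) - A (v n))"
          using lower_bound_onD[OF c(2), of "v k - v n"]
            bounded_op_on_diff[OF complex_vector.subspace_UNIV A, of "v k" "v n"] by (simp add: A_def)
        also have "\<dots> < c * e"
          using N that by blast
        finally show ?thesis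
          using c(1) by simp
      qed
      then show "\<exists>N. \<forall>k\<ge>N. \<forall>n\<ge>N. norm (v k - v n) < e" by blast
    qed
    then obtain u where "v \<longlonglongrightarrow> u"
      using Cauchy_convergent convergent_def by blast
    moreover have "bounded_linear A"
      using A by (simp add: bounded_op_on_UNIV_iff)
    ultimately have "(\<lambda>n. A (v n)) \<longlonglongrightarrow> A u"
      by (rule bounded_linear.tendsto[rotated])
    with Av have "w = A u"
      by (rule LIMSEQ_unique)
    then show ?thesis by blast
  qed
  then show "invertible_on UNIV (\<lambda>v. z *\<^sub>C v - X v)"
    using invertible_onI[OF complex_vector.subspace_UNIV A c(1)] c(2) by (auto simp: A_def)
qed

lemma eventually_avoids:
  assumes "z \<notin> approx_pseudospectrum_on \<epsilon> UNIV X"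
  shows "\<exists>r>0. \<forall>\<^sub>F n in sequentially. approx_pseudospectrum_on \<epsilon> (range (P n)) (Xn n) \<inter> ball z r = {}"
proof -
  obtain c where c: "c > \<epsilon>" "lower_bound_on UNIV (\<lambda>v. z *\<^sub>C v - X v) c"
    using assms by (auto simp: approx_pseudospectrum_on_def)
  \<comment> \<open>The gap \<open>c - \<epsilon>\<close> is shared equally between the distance to
    \<open>z\<close> and the error \<open>\<delta> n\<close>.\<close>
  define r where "r = (c - \<epsilon>) / 2"
  have r: "r > 0"
    using c(1) by (simp add: r_def)
  have "\<forall>\<^sub>F n in sequentially. approx_pseudospectrum_on \<epsilon> (range (P n)) (Xn n) \<inter> ball z r = {}"
    using order_tendstoD(2)[OF \<delta>_lim r]
  proof eventually_elim
    case (elim n)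
    have "w \<notin> approx_pseudospectrum_on \<epsilon> (range (P n)) (Xn n)" if "w \<in> ball z r" for w
    proof -
      have "lower_bound_on (range (P n)) (\<lambda>v. w *\<^sub>C v - Xn n v) (c - dist w z - \<delta> n)"
        using c(2) subset_UNIV X_Xn by (rule lower_bound_on_perturb)
      moreover have "dist w z < r"
        using that by (simp add: dist_commute)
      then have "c - dist w z - \<delta> n > \<epsilon>"
        using elim unfolding r_def by (simp add: field_simps)
      ultimately show ?thesis
        by (auto simp: approx_pseudospectrum_on_def)
    qed
    then show ?case by blast
  qed
  with r show ?thesis by blast
qed

text \<open>The vectors \<open>P n v\<close> work: both sides converge to their values at
  \<open>v\<close>, and the strict inequality leaves room for the error
  \<open>\<delta> n\<close>.\<close>

lemma eventually_approx_eigenvector: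
  assumes "norm (z *\<^sub>C v - X v) < e * norm v"
  shows "\<forall>\<^sub>F n in sequentially. \<exists>u\<in>range (P n). norm (z *\<^sub>C u - Xn n u) < e * norm u"
proof -
  have "bounded_op_on UNIV (\<lambda>v. z *\<^sub>C v - X v)"
    by (rule bounded_op_on_shift[OF complex_vector.subspace_UNIV X])
  then have "bounded_linear (\<lambda>v. z *\<^sub>C v - X v)"
    by (simp add: bounded_op_on_UNIV_iff)
  then have A_lim: "(\<lambda>n. z *\<^sub>C P n v - X (P n v)) \<longlonglongrightarrow> z *\<^sub>C v - X v"
    by (rule bounded_linear.tendsto) (rule P_lim)
  have "(\<lambda>n. e * norm (P n v) - norm (z *\<^sub>C P n v - X (P n v)) - \<delta> n * norm (P n v))
      \<longlonglongrightarrow> e * norm v - norm (z *\<^sub>C v - X v) - 0 * norm v"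
    by (intro tendsto_diff[OF tendsto_diff] tendsto_mult tendsto_const tendsto_norm A_lim P_lim \<delta>_lim)
  then have "\<forall>\<^sub>F n in sequentially. 0 < e * norm (P n v) - norm (z *\<^sub>C P n v - X (P n v)) - \<delta> n * norm (P n v)"
    by (rule order_tendstoD(1)) (use assms in simp)
  then show ?thesis
  proof eventually_elim
    case (elim n)
    have "norm (z *\<^sub>C P n v - Xn n (P n v)) \<le> norm (z *\<^sub>C P n v - X (P n v)) + norm (X (P n v) - Xn n (P n v))"
      using norm_triangle_ineq[of "z *\<^sub>C P n v - X (P n v)" "X (P n v) - Xn n (P n v)"] by simp
    with elim X_Xn[of "P n v" n] show ?case
      by (intro bexI[of _ "P n v"]) auto
  qed
qed

lemma eventually_bounded:
  "\<exists>R. \<forall>\<^sub>F n in sequentially. approx_pseudospectrum_on \<epsilon> (range (P n)) (Xn n) \<subseteq> cball 0 R"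
proof -
  obtain K where K: "K > 0" "\<And>v. norm (X v) \<le> K * norm v"
    using bounded_op_on_UNIV_bound[OF X] by metis
  have "\<forall>\<^sub>F n in sequentially. approx_pseudospectrum_on \<epsilon> (range (P n)) (Xn n) \<subseteq> cball 0 (K + 1 + \<epsilon>)"
    using order_tendstoD(2)[OF \<delta>_lim zero_less_one]
  proof eventually_elim
    case (elim n)
    have "norm (Xn n v) \<le> (K + 1) * norm v" if v: "v \<in> range (P n)" for v
    proof -
      have "norm (Xn n v) \<le> norm (X v) + norm (X v - Xn n v)"
        using norm_triangle_ineq4[of "X v" "X v - Xn n v"] by simp
      moreover have "norm (X v - Xn n v) \<le> 1 * norm v"
        using order_trans[OF X_Xn[OF v] mult_right_mono[OF less_imp_le[OF elim] norm_ge_zero]] .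
      ultimately show ?thesis
        using K(2)[of v] by (simp add: algebra_simps)
    qed
    then show ?case
      by (rule approx_pseudospectrum_subset_cball)
  qed
  then show ?thesis by blast
qed

lemma approx_pseudospectrum_tendsto:
  assumes \<epsilon>: "\<epsilon> > 0"
  shows "hausdorff_tendsto (\<lambda>n. approx_pseudospectrum_on \<epsilon> (range (P n)) (Xn n))
    (approx_pseudospectrum_on \<epsilon> UNIV X)"
proof -
  obtain R where R: "\<forall>\<^sub>F n in sequentially. approx_pseudospectrum_on \<epsilon> (range (P n)) (Xn n) \<subseteq> cball 0 R"
    using eventually_bounded by blast
  show ?thesis
  proof (rule hausdorff_tendstoI[OF _ _ compact_cball R])
    fix z r assume z: "z \<in> approx_pseudospectrum_on \<epsilon> UNIV X" and r: "r > (0::real)"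
    \<comment> \<open>At \<open>z\<close> itself the level \<open>\<epsilon>\<close> might only be
      an infimum; at the nearby \<open>w\<close> some vector lies strictly below it, and this
      persists under compression.\<close>
    obtain w v where w: "dist w z < r" "norm (w *\<^sub>C v - X v) < \<epsilon> * norm v"
      using resolvent_norm_not_locally_constant[OF X bounded_below_invertible_limit \<epsilon> z r] by blast
    show "\<forall>\<^sub>F n in sequentially. approx_pseudospectrum_on \<epsilon> (range (P n)) (Xn n) \<inter> ball z r \<noteq> {}"
      using eventually_approx_eigenvector[OF w(2)]
    proof eventually_elim
      case (elim n)
      then obtain u where u: "u \<in> range (P n)" "norm (w *\<^sub>C u - Xn n u) < \<epsilon> * norm u" by blast
      have "\<not> lower_bound_on (range (P n)) (\<lambda>v. w *\<^sub>C v - Xn n v) c" if "c > \<epsilon>" for c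
      proof
        assume "lower_bound_on (range (P n)) (\<lambda>v. w *\<^sub>C v - Xn n v) c"
        then have "c * norm u \<le> norm (w *\<^sub>C u - Xn n u)"
          using u(1) by (rule lower_bound_onD)
        moreover have "\<epsilon> * norm u \<le> c * norm u"
          using that by (intro mult_right_mono) auto
        ultimately show False
          using u(2) by linarith
      qed
      then have "w \<in> approx_pseudospectrum_on \<epsilon> (range (P n)) (Xn n)"
        by (auto simp: approx_pseudospectrum_on_def)
      moreover have "w \<in> ball z r"
        using w(1) by (simp add: dist_commute)
      ultimately show ?case
        by blast
    qed
  qed (simp_all add: compact_approx_pseudospectrum[OF Xn] compact_approx_pseudospectrum[OF X] eventually_avoids)
qed

text \<open>Level 0 leaves no room for strict inequalities. A limit point is approached instead
  through approximate eigenvectors with a positive tolerance; symmetry converts these into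
  approximate eigenvalues of \<open>Xn n\<close>, and positivity allows taking their square
  roots.\<close>

lemma nonneg_sqrt_set_tendsto:
  assumes sym: "\<And>n v w. v \<in> range (P n) \<Longrightarrow> w \<in> range (P n) \<Longrightarrow> cinner (Xn n v) w = cinner v (Xn n w)"
    and pos: "\<And>n v. v \<in> range (P n) \<Longrightarrow> 0 \<le> Re (cinner (Xn n v) v)"
  shows "hausdorff_tendsto (\<lambda>n. nonneg_sqrt_set (approx_pseudospectrum_on 0 (range (P n)) (Xn n)))
    (nonneg_sqrt_set (approx_pseudospectrum_on 0 UNIV X))"
proof -
  obtain R where R: "\<forall>\<^sub>F n in sequentially. approx_pseudospectrum_on 0 (range (P n)) (Xn n) \<subseteq> cball 0 R"
    using eventually_bounded by blast
  then have R': "\<forall>\<^sub>F n in sequentially. nonneg_sqrt_set (approx_pseudospectrum_on 0 (range (P n)) (Xn n))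
      \<subseteq> nonneg_sqrt_set (cball 0 R)"
    by eventually_elim (auto simp: nonneg_sqrt_set_def)
  show ?thesis
  proof (rule hausdorff_tendstoI[OF _ _ compact_nonneg_sqrt_set[OF compact_cball] R'])
    fix z assume z: "z \<notin> nonneg_sqrt_set (approx_pseudospectrum_on 0 UNIV X)"
    show "\<exists>r>0. \<forall>\<^sub>F n in sequentially.
        nonneg_sqrt_set (approx_pseudospectrum_on 0 (range (P n)) (Xn n)) \<inter> ball z r = {}"
    \<comment> \<open>If the square is spectral, \<open>z\<close> must lie off the closed
      nonnegative half-line, which contains all the sets; otherwise continuity of squaring pulls
      back the avoidance of a ball around \<open>z\<^sup>2\<close>.\<close>
    proof (cases "z\<^sup>2 \<in> approx_pseudospectrum_on 0 UNIV X")
      case True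
      have "closed ({z. 0 \<le> Re z} \<inter> {z. Im z = 0})"
        by (intro closed_Int closed_Collect_le closed_Collect_eq continuous_intros)
      then have "open (- ({z. 0 \<le> Re z} \<inter> {z. Im z = 0}))"
        by (rule open_Compl)
      moreover have "z \<in> - ({z. 0 \<le> Re z} \<inter> {z. Im z = 0})"
        using True z by (auto simp: nonneg_sqrt_set_iff)
      ultimately obtain r where "r > 0" "ball z r \<subseteq> - ({z. 0 \<le> Re z} \<inter> {z. Im z = 0})"
        by (auto simp: open_contains_ball)
      then have "\<forall>n. nonneg_sqrt_set (approx_pseudospectrum_on 0 (range (P n)) (Xn n)) \<inter> ball z r = {}"
        by (auto simp: nonneg_sqrt_set_iff)
      with \<open>r > 0\<close> show ?thesis by auto
    next
      case False
      then obtain r where r: "r > 0"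
        "\<forall>\<^sub>F n in sequentially. approx_pseudospectrum_on 0 (range (P n)) (Xn n) \<inter> ball (z\<^sup>2) r = {}"
        using eventually_avoids by blast
      have "continuous (at z) (\<lambda>w. w\<^sup>2)"
        by (intro continuous_intros)
      then obtain s where s: "s > 0" "\<And>w. dist w z < s \<Longrightarrow> dist (w\<^sup>2) (z\<^sup>2) < r"
        using r(1) unfolding continuous_at_eps_delta by meson
      have "\<forall>\<^sub>F n in sequentially. nonneg_sqrt_set (approx_pseudospectrum_on 0 (range (P n)) (Xn n)) \<inter> ball z s = {}"
        using r(2)
      proof eventually_elim
        case (elim n)
        then show ?case
          using s(2) by (force simp: nonneg_sqrt_set_iff dist_commute)
      qed
      with s(1) show ?thesis by blast
    qed
  next
    fix z r assume z: "z \<in> nonneg_sqrt_set (approx_pseudospectrum_on 0 UNIV X)" and r: "r > (0::real)"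
    obtain s where s: "z = complex_of_real s" "0 \<le> s" "complex_of_real (s\<^sup>2) \<in> approx_pseudospectrum_on 0 UNIV X"
      using z by (auto simp: nonneg_sqrt_set_def)
    \<comment> \<open>The tolerance is \<open>r\<^sup>2\<close> because the square root is only
      Hoelder continuous of order 1/2 near 0.\<close>
    have "\<not> lower_bound_on UNIV (\<lambda>v. complex_of_real (s\<^sup>2) *\<^sub>C v - X v) (r\<^sup>2)"
      using s(3) r unfolding approx_pseudospectrum_on_def by fastforce
    then obtain v where v: "norm (complex_of_real (s\<^sup>2) *\<^sub>C v - X v) < r\<^sup>2 * norm v"
      by (auto simp: lower_bound_on_def not_le)
    show "\<forall>\<^sub>F n in sequentially. nonneg_sqrt_set (approx_pseudospectrum_on 0 (range (P n)) (Xn n)) \<inter> ball z r \<noteq> {}"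
      using eventually_approx_eigenvector[OF v]
    proof eventually_elim
      case (elim n)
      then obtain u where u: "u \<in> range (P n)"
        "norm (complex_of_real (s\<^sup>2) *\<^sub>C u - Xn n u) < r\<^sup>2 * norm u" by blast
      obtain k where k: "\<bar>k - s\<^sup>2\<bar> < r\<^sup>2" "complex_of_real k \<in> approx_pseudospectrum_on 0 (range (P n)) (Xn n)"
        using approx_eigenvalue_near[OF subspace_range Xn sym u] by blast
      have k0: "k \<ge> 0"
        by (rule positive_approx_eigenvalue_nonneg[OF pos k(2)])
      \<comment> \<open>Multiplied by \<open>\<bar>sqrt k - s\<bar>\<close>, this bounds the squared
        distance of the roots by \<open>\<bar>k - s\<^sup>2\<bar>\<close>.\<close>
      have "\<bar>sqrt k - s\<bar> \<le> sqrt k + s"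
        using s(2) k0 by (simp add: abs_le_iff)
      then have "\<bar>sqrt k - s\<bar>\<^sup>2 \<le> \<bar>sqrt k - s\<bar> * (sqrt k + s)"
        unfolding power2_eq_square by (rule mult_left_mono) simp
      also have "\<dots> = \<bar>(sqrt k - s) * (sqrt k + s)\<bar>"
        using s(2) k0 by (simp add: abs_mult)
      also have "(sqrt k - s) * (sqrt k + s) = k - s\<^sup>2"
        using k0 by (simp add: algebra_simps power2_eq_square)
      also note k(1)
      finally have "\<bar>sqrt k - s\<bar>\<^sup>2 < r\<^sup>2" .
      then have "\<bar>sqrt k - s\<bar> < r"
        by (rule power_less_imp_less_base) (use r in simp)
      then have "complex_of_real (sqrt k) \<in> ball z r"
        by (simp add: s(1) dist_norm abs_minus_commute flip: of_real_diff)
      moreover have "complex_of_real (sqrt k) \<in> nonneg_sqrt_set (approx_pseudospectrum_on 0 (range (P n)) (Xn n))"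
        using k(2) k0 by (simp add: nonneg_sqrt_set_iff flip: of_real_power)
      ultimately show ?case by blast
    qed
  qed (simp_all add: compact_nonneg_sqrt_set compact_approx_pseudospectrum[OF Xn] compact_approx_pseudospectrum[OF X])
qed

end

lemma bounded_linear_commutator:
  assumes "bounded_op_on UNIV S" "bounded_op_on UNIV T"
  shows "bounded_linear (commutator S T)"
  using assms unfolding commutator_def
  by (auto simp: bounded_op_on_UNIV_iff intro: bounded_linear_sub bounded_linear_compose)

theorem theorem3p5:
  fixes T :: "'a::chilbert_space \<Rightarrow> 'a" and P :: "nat \<Rightarrow> 'a \<Rightarrow> 'a"
  assumes separable: "separable_space (euclidean :: 'a topology)"
    and T_bounded: "bounded_op_on UNIV T"
    and T_quasidiagonal: "quasidiagonal T"
    and P_filtration: "filtration P"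
    and P_commutes: "(\<lambda>n. onorm (commutator (P n) T)) \<longlonglongrightarrow> 0"
  shows "(\<forall>\<epsilon>>0. hausdorff_tendsto
            (\<lambda>n. pseudospectrum_on \<epsilon> (range (P n)) (P n \<circ> T \<circ> P n))
            (pseudospectrum_on \<epsilon> UNIV T))
     \<and> ((\<forall>\<epsilon>>0. hausdorff_lim (\<lambda>n. pseudospectrum_on \<epsilon> (range (P n)) (P n \<circ> T \<circ> P n))
            = pseudospectrum_on \<epsilon> UNIV T)
       \<and> spectrum_on UNIV T
          = (\<Inter>\<epsilon>\<in>{0<..}. hausdorff_lim
              (\<lambda>n. pseudospectrum_on \<epsilon> (range (P n)) (P n \<circ> T \<circ> P n))))
     \<and> hausdorff_tendsto
         (\<lambda>n. singular_values_on (range (P n)) (P n \<circ> T \<circ> P n))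
         (singular_values_on UNIV T)"
proof -
  define d where "d n = onorm (commutator (P n) T)" for n
  define A where "A n = P n \<circ> T \<circ> P n" for n
  have proj: "orthogonal_projection (P n)" and rank: "finite_rank (P n)" for n
    using P_filtration by (auto simp: filtration_def)
  have P_lim: "(\<lambda>n. P n v) \<longlonglongrightarrow> v" for v
    using P_filtration by (simp add: filtration_def LIM_zero_iff tendsto_norm_zero_iff)
  have d_lim: "d \<longlonglongrightarrow> 0"
    using P_commutes unfolding d_def .
  note P = orthogonal_projectionD[OF proj]
  have P_range: "P n v = v" if "v \<in> range (P n)" for n v
    using that orthogonal_projection_range[OF proj] by blast
  have PT: "norm (P n (T v) - T (P n v)) \<le> d n * norm v" for n v
    using onorm[OF bounded_linear_commutator[OF P(1) T_bounded]] by (simp add: d_def commutator_def)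
  have bounded_A: "bounded_op_on UNIV (A n)" for n
    unfolding A_def by (intro bounded_op_on_comp P(1) T_bounded)
  have A: "bounded_op_on (range (P n)) (A n)" for n
    using bounded_A[of n] unfolding bounded_op_on_def by (auto simp: A_def)

  interpret T: asymptotic_compression P T A d
  proof
    \<comment> \<open>On the range, \<open>v = P n v\<close>, so the difference is, up to sign, the
      commutator applied to \<open>v\<close>.\<close>
    show "norm (T v - A n v) \<le> d n * norm v" if "v \<in> range (P n)" for n v
      using PT[of n v] P_range[OF that] by (simp add: A_def norm_minus_commute)
  qed (use proj rank P_lim T_bounded A d_lim in auto)
  have psp: "pseudospectrum_on \<epsilon> (range (P n)) (A n) = approx_pseudospectrum_on \<epsilon> (range (P n)) (A n)"
    "pseudospectrum_on \<epsilon> UNIV T = approx_pseudospectrum_on \<epsilon> UNIV T" if "\<epsilon> > 0" for \<epsilon> n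
    using that T.bounded_below_invertible_compression T.bounded_below_invertible_limit
    by (simp_all add: pseudospectrum_on_eq T.subspace_range A T_bounded complex_vector.subspace_UNIV)
  have conv: "hausdorff_tendsto (\<lambda>n. pseudospectrum_on \<epsilon> (range (P n)) (A n)) (pseudospectrum_on \<epsilon> UNIV T)"
    if "\<epsilon> > 0" for \<epsilon>
    using T.approx_pseudospectrum_tendsto[OF that] by (simp add: psp[OF that])
  have lim: "hausdorff_lim (\<lambda>n. pseudospectrum_on \<epsilon> (range (P n)) (A n)) = pseudospectrum_on \<epsilon> UNIV T"
    if "\<epsilon> > 0" for \<epsilon>
    by (rule hausdorff_lim_eq[OF conv[OF that]])
  have spec: "spectrum_on UNIV T = (\<Inter>\<epsilon>\<in>{0<..}. hausdorff_lim (\<lambda>n. pseudospectrum_on \<epsilon> (range (P n)) (A n)))"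
    using spectrum_on_eq[OF complex_vector.subspace_UNIV T_bounded T.bounded_below_invertible_limit]
    by (simp add: lim psp(2) approx_pseudospectrum_zero)

  define T' where "T' = adjoint_on UNIV T"
  have T': "is_adjoint_on UNIV T T'"
    using ex_adjoint[OF T_bounded] is_adjoint_on_adjoint_on unfolding T'_def by blast
  then have T'_bounded: "bounded_op_on UNIV T'" and adj: "cinner (T v) w = cinner v (T' w)" for v w
    by (auto simp: is_adjoint_on_def)
  obtain K where K: "K > 0" "\<And>v. norm (T v) \<le> K * norm v"
    using bounded_op_on_UNIV_bound[OF T_bounded] by metis
  have K': "norm (T' v) \<le> K * norm v" for v
    using adj K(2) by (rule adjoint_norm_le)
  \<comment> \<open>The adjoint of the commutator of \<open>P n\<close> and \<open>T\<close> is the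
    commutator of \<open>T'\<close> and \<open>P n\<close>, so \<open>T'\<close> asymptotically
    commutes at the same rate.\<close>
  have PT': "norm (T' (P n w) - P n (T' w)) \<le> d n * norm w" for n w
  proof (rule adjoint_norm_le[OF _ PT])
    show "cinner (P n (T v) - T (P n v)) w = cinner v (T' (P n w) - P n (T' w))" for v w
      by (simp add: cinner_simps adj P(2))
  qed
  define A' where "A' n = adjoint_on (range (P n)) (A n)" for n
  have adjA: "is_adjoint_on (range (P n)) (A n) (P n \<circ> T')" for n
  proof -
    have "bounded_op_on UNIV (P n \<circ> T')"
      by (rule bounded_op_on_comp[OF P(1) T'_bounded])
    then have "bounded_op_on (range (P n)) (P n \<circ> T')"
      unfolding bounded_op_on_def by auto
    moreover have "cinner (A n v) w = cinner v ((P n \<circ> T') w)" if "v \<in> range (P n)" "w \<in> range (P n)" for v w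
      using P_range[OF that(1)] P_range[OF that(2)] by (simp add: A_def P(2) adj) (metis P(2))
    ultimately show ?thesis
      by (simp add: is_adjoint_on_def)
  qed
  have A': "is_adjoint_on (range (P n)) (A n) (A' n)" for n
    unfolding A'_def by (rule is_adjoint_on_adjoint_on[OF adjA])
  then have A'_bounded: "bounded_op_on (range (P n)) (A' n)" for n
    by (simp add: is_adjoint_on_def)
  have adj': "cinner (A n v) w = cinner v (A' n w)" if "v \<in> range (P n)" "w \<in> range (P n)" for n v w
    using A' that unfolding is_adjoint_on_def by blast
  have adj'': "cinner (A' n v) w = cinner v (A n w)" if "v \<in> range (P n)" "w \<in> range (P n)" for n v w
    using adj'[OF that(2,1)] cinner_commute by metis
  \<comment> \<open>\<open>adjoint_on\<close> makes a choice that is determined only on the range,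
    so the formula is claimed only there.\<close>
  have A'_eq: "A' n w = P n (T' w)" if "w \<in> range (P n)" for n w
    using is_adjoint_on_unique[OF T.subspace_range A' adjA that] by simp

  interpret TT: asymptotic_compression P "T' \<circ> T" "\<lambda>n. A' n \<circ> A n" "\<lambda>n. 2 * K * d n"
  proof
    show "bounded_op_on UNIV (T' \<circ> T)"
      by (rule bounded_op_on_comp[OF T'_bounded T_bounded])
    show "bounded_op_on (range (P n)) (A' n \<circ> A n)" for n
      by (rule bounded_op_on_comp[OF A'_bounded A])
    show "(\<lambda>n. 2 * K * d n) \<longlonglongrightarrow> 0"
      by (rule tendsto_mult_right_zero[OF d_lim])
    show "norm ((T' \<circ> T) v - (A' n \<circ> A n) v) \<le> 2 * K * d n * norm v" if v: "v \<in> range (P n)" for n v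
    proof -
      \<comment> \<open>The error splits as \<open>T' (T v - w)\<close> plus
        \<open>T' w - P n (T' w)\<close>. Each part contains one commutator, of norm at most
        \<open>d n\<close>, and one factor bounded by \<open>K\<close>; this is the origin of
        \<open>2 * K * d n\<close>.\<close>
      define w where "w = P n (T v)"
      have Aw: "A n v = w"
        using P_range[OF v] by (simp add: A_def w_def)
      have w: "P n w = w"
        by (simp add: w_def P(3))
      have "norm (T' (T v - w)) \<le> K * norm (T v - w)"
        by (rule K')
      also have "\<dots> \<le> K * (d n * norm v)"
        using PT[of n v] P_range[OF v] K(1) by (intro mult_left_mono) (simp_all add: w_def norm_minus_commute)
      finally have 1: "norm (T' (T v - w)) \<le> K * d n * norm v"
        by simp
      have dn: "0 \<le> d n"
        unfolding d_def by (rule onorm_pos_le[OF bounded_linear_commutator[OF P(1) T_bounded]])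
      have "norm (T' w - P n (T' w)) \<le> d n * norm w"
        using PT'[of n w] w by simp
      also have "norm w \<le> K * norm v"
        unfolding w_def using orthogonal_projection_norm_le[OF proj] K(2) by (rule order_trans)
      then have "d n * norm w \<le> d n * (K * norm v)"
        using dn by (rule mult_left_mono)
      finally have 2: "norm (T' w - P n (T' w)) \<le> K * d n * norm v"
        by (simp add: mult_ac)
      have "A' n w = P n (T' w)"
        using w by (intro A'_eq) (metis rangeI)
      then have "(T' \<circ> T) v - (A' n \<circ> A n) v = T' (T v - w) + (T' w - P n (T' w))"
        using bounded_op_on_diff[OF complex_vector.subspace_UNIV T'_bounded, of "T v" w] by (simp add: Aw)
      then have "norm ((T' \<circ> T) v - (A' n \<circ> A n) v) \<le> norm (T' (T v - w)) + norm (T' w - P n (T' w))"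
        by (simp only: norm_triangle_ineq)
      with 1 2 show ?thesis
        by (simp add: algebra_simps)
    qed
  qed (use proj rank P_lim in auto)
  have "hausdorff_tendsto (\<lambda>n. nonneg_sqrt_set (approx_pseudospectrum_on 0 (range (P n)) (A' n \<circ> A n)))
    (nonneg_sqrt_set (approx_pseudospectrum_on 0 UNIV (T' \<circ> T)))"
  proof (rule TT.nonneg_sqrt_set_tendsto)
    show "cinner ((A' n \<circ> A n) v) w = cinner v ((A' n \<circ> A n) w)"
      if "v \<in> range (P n)" "w \<in> range (P n)" for n v w
      using that bounded_op_onD(1)[OF A] by (simp add: adj' adj'')
    show "0 \<le> Re (cinner ((A' n \<circ> A n) v) v)" if "v \<in> range (P n)" for n v
      using that bounded_op_onD(1)[OF A] by (simp add: adj'' cinner_self)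
  qed
  moreover have "spectrum_on (range (P n)) (A' n \<circ> A n) = approx_pseudospectrum_on 0 (range (P n)) (A' n \<circ> A n)" for n
    by (rule spectrum_on_eq[OF TT.subspace_range TT.Xn TT.bounded_below_invertible_compression])
  moreover have "spectrum_on UNIV (T' \<circ> T) = approx_pseudospectrum_on 0 UNIV (T' \<circ> T)"
    by (rule spectrum_on_eq[OF complex_vector.subspace_UNIV TT.X TT.bounded_below_invertible_limit])
  ultimately have "hausdorff_tendsto (\<lambda>n. singular_values_on (range (P n)) (A n)) (singular_values_on UNIV T)"
    unfolding singular_values_on_def nonneg_sqrt_set_def A'_def T'_def by simp
  with conv lim spec show ?thesis
    unfolding A_def by simp
qed

end
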